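(* For every real $p\in(1,2]$ there exists a constant $c_p\in(0,2)$ such that $$\Delta_p(n)\ \ge\ (1+o_n(1))\,\frac{\log(2/c_p)\cdot n}{2^n}\qquad (n\to\infty).$$
   Context: $\log$ is the natural logarithm. For $p\ge1$ the $\ell_p$-ball of radius $r$ centered at $\mathbf{x}\in\mathbb{R}^n$ is $\{\mathbf{y}\in\mathbb{R}^n:(\sum_{j=1}^n|x_j-y_j|^p)^{1/p}\le r\}$. Let $r_n$ be the radius for which this ball has volume $1$. $\Delta_p(n)$ denotes the maximum translative packing density of $\ell_p$-balls of volume $1$ in $\mathbb{R}^n$: $$\Delta_p(n)=\limsup_{R\to\infty}\sup_{\mathcal{P}}\frac{\mathrm{vol}\big(B(\mathbf 0,R)\cap\bigcup_{\mathbf{x}\in\mathcal{P}}B(\mathbf{x},r_n)\big)}{\mathrm{vol}(B(\mathbf 0,R))},$$ where $B(\mathbf{x},r)$ is the $\ell_p$-ball and the supremum is over all $\mathcal{P}\subseteq\mathbb{R}^n$ such that the balls $B(\mathbf{x},r_n)$, $\mathbf{x}\in\mathcal{P}$, have pairwise disjoint interiors. *)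

theory Defs
  imports "HOL-Analysis.Analysis" "HOL-Library.Liminf_Limsup"
begin

definition Rn :: "nat \<Rightarrow> (nat \<Rightarrow> real) set" where
  "Rn n = PiE {..<n} (\<lambda>_. UNIV)"

definition lebn :: "nat \<Rightarrow> (nat \<Rightarrow> real) measure" where
  "lebn n = PiM {..<n} (\<lambda>_. lborel)"

definition lp_dist :: "real \<Rightarrow> nat \<Rightarrow> (nat \<Rightarrow> real) \<Rightarrow> (nat \<Rightarrow> real) \<Rightarrow> real" where
  "lp_dist p n x y = (\<Sum>j<n. \<bar>x j - y j\<bar> powr p) powr (1 / p)"

definition lp_ball :: "real \<Rightarrow> nat \<Rightarrow> (nat \<Rightarrow> real) \<Rightarrow> real \<Rightarrow> (nat \<Rightarrow> real) set" where
  "lp_ball p n x r = {y \<in> Rn n. lp_dist p n x y \<le> r}"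

text \<open>Open l_p ball: the interior of B(x,r) in R^n (for r > 0, p >= 1).\<close>
definition lp_open_ball :: "real \<Rightarrow> nat \<Rightarrow> (nat \<Rightarrow> real) \<Rightarrow> real \<Rightarrow> (nat \<Rightarrow> real) set" where
  "lp_open_ball p n x r = {y \<in> Rn n. lp_dist p n x y < r}"

definition unit_vol_radius :: "real \<Rightarrow> nat \<Rightarrow> real" where
  "unit_vol_radius p n = (THE r. 0 < r \<and> measure (lebn n) (lp_ball p n (\<lambda>_. 0) r) = 1)"

definition lp_packings :: "real \<Rightarrow> nat \<Rightarrow> (nat \<Rightarrow> real) set set" where
  "lp_packings p n = {P. P \<subseteq> Rn n \<and>
     (\<forall>x\<in>P. \<forall>y\<in>P. x \<noteq> y \<longrightarrow>
        lp_open_ball p n x (unit_vol_radius p n) \<inter> lp_open_ball p n y (unit_vol_radius p n) = {})}"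

definition packing_density :: "real \<Rightarrow> nat \<Rightarrow> ereal" where
  "packing_density p n = Limsup at_top (\<lambda>R::real.
     (SUP P\<in>lp_packings p n.
        ereal (measure (lebn n) (lp_ball p n (\<lambda>_. 0) R \<inter> (\<Union>x\<in>P. lp_ball p n x (unit_vol_radius p n)))
               / measure (lebn n) (lp_ball p n (\<lambda>_. 0) R))))"

end

theory Submission
  imports Defs
begin

text \<open>Let \<open>r\<close> be the radius of the ball of volume 1. Join two points of a fine grid in a large ball
  when their distance is less than \<open>2r\<close>; independent sets are packings. By uniform convexity of the
  \<open>l\<^sub>p\<close>-norm, each neighbourhood is sparse: within the neighbourhood of \<open>v\<close>, a vertex \<open>u\<close> has
  exponentially fewer than \<open>deg v\<close> neighbours that are at least as close to \<open>v\<close> as \<open>u\<close> is.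
  In the hard-core model on such a graph with a fugacity exponentially larger than the inverse
  degree, a vertex \<open>v\<close> is either likely to be occupied (if few of its neighbours are available) or
  has order \<open>n\<close> occupied neighbours on average. This gains the factor \<open>n\<close> over the greedy bound
  \<open>2\<^sup>-\<^sup>n\<close>. Any gain linear in \<open>n\<close> suffices because \<open>c\<close> may be chosen close to 2.\<close>

section \<open>Hard-core model on a locally sparse graph\<close>

text \<open>Weighting an independent set \<open>I\<close> by \<open>l ^ card I\<close> gives the
  hard-core model with fugacity \<open>l\<close>. No vertex set is fixed, so that partition
  functions of different vertex sets can be compared.\<close>

locale hard_core =
  fixes E :: "'a \<Rightarrow> 'a \<Rightarrow> bool" and l :: real
  assumes sym: "E x y \<Longrightarrow> E y x" and irrefl: "\<not> E x x" and l_pos: "0 < l"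
begin

definition indep :: "'a set \<Rightarrow> 'a set set" where
  "indep S = {I. I \<subseteq> S \<and> (\<forall>x\<in>I. \<forall>y\<in>I. \<not> E x y)}"

definition Z :: "'a set \<Rightarrow> real" where
  "Z S = (\<Sum>I\<in>indep S. l ^ card I)"

text \<open>With \<open>Z\<close> as partition function, \<open>M S / Z S\<close> is the expected
  size of a random independent subset of \<open>S\<close>.\<close>

definition M :: "'a set \<Rightarrow> real" where
  "M S = (\<Sum>I\<in>indep S. l ^ card I * real (card I))"

definition cnbh :: "'a \<Rightarrow> 'a set" where
  "cnbh u = {w. w = u \<or> E u w}"

lemma finite_indep [simp]: "finite S \<Longrightarrow> finite (indep S)"
  by (rule finite_subset[of _ "Pow S"]) (auto simp: indep_def)

lemma indep_finite: "finite S \<Longrightarrow> I \<in> indep S \<Longrightarrow> finite I"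
  by (auto simp: indep_def intro: finite_subset)

lemma empty_indep [simp]: "{} \<in> indep S"
  by (auto simp: indep_def)

lemma indep_empty: "indep {} = {{}}"
  by (auto simp: indep_def)

lemma indep_mono: "S \<subseteq> S' \<Longrightarrow> indep S \<subseteq> indep S'"
  by (auto simp: indep_def)

lemma Z_empty [simp]: "Z {} = 1"
  by (simp add: Z_def indep_empty)

lemma Z_pos: "finite S \<Longrightarrow> 0 < Z S"
  unfolding Z_def using l_pos by (intro sum_pos2[of _ "{}"]) auto

text \<open>Removing \<open>u\<close> is a bijection onto the independent sets that avoid
  \<open>u\<close> and its neighbours; \<open>u\<close> itself contributes the factor
  \<open>l\<close>.\<close>

lemma sum_indep_containing:
  assumes "finite S" "u \<in> S"
  shows "(\<Sum>I\<in>{I\<in>indep S. u \<in> I}. l ^ card I) = l * Z (S - cnbh u)"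
proof -
  have "(\<Sum>I\<in>{I\<in>indep S. u \<in> I}. l ^ card I) = (\<Sum>J\<in>indep (S - cnbh u). l ^ Suc (card J))"
  proof (rule sum.reindex_bij_witness[of _ "insert u" "\<lambda>I. I - {u}"])
    fix I assume I: "I \<in> {I \<in> indep S. u \<in> I}"
    then have "finite I" using assms indep_finite by auto
    then show "l ^ Suc (card (I - {u})) = l ^ card I"
      using I by (metis (no_types, lifting) card_Suc_Diff1 mem_Collect_eq)
  qed (use assms sym irrefl in \<open>auto simp: indep_def cnbh_def\<close>)
  then show ?thesis by (simp add: Z_def sum_distrib_left)
qed

lemma Z_insert_le:
  assumes "finite S"
  shows "Z (insert u S) \<le> (1 + l) * Z S"
proof (cases "u \<in> S")
  case True
  then show ?thesis using Z_pos[OF assms] l_pos by (simp add: insert_absorb algebra_simps)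
next
  case False
  have eq: "indep (insert u S) = indep S \<union> {I\<in>indep (insert u S). u \<in> I}"
    by (auto simp: indep_def)
  have "Z (insert u S) = Z S + (\<Sum>I\<in>{I\<in>indep (insert u S). u \<in> I}. l ^ card I)"
    unfolding Z_def by (subst eq, rule sum.union_disjoint) (use assms False in \<open>auto simp: indep_def\<close>)
  also have "\<dots> = Z S + l * Z (insert u S - cnbh u)"
    using assms by (subst sum_indep_containing) auto
  also have "Z (insert u S - cnbh u) \<le> Z S"
    unfolding Z_def using assms l_pos
    by (intro sum_mono2 indep_mono) (auto simp: cnbh_def)
  finally show ?thesis using l_pos by (simp add: algebra_simps)
qed

lemma Z_union_le:
  assumes "finite S" "finite U"
  shows "Z (U \<union> S) \<le> (1 + l) ^ card U * Z S"
  using assms(2)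
proof induction
  case (insert u U)
  have "Z (insert u (U \<union> S)) \<le> (1 + l) * Z (U \<union> S)"
    using insert assms by (intro Z_insert_le) auto
  also have "\<dots> \<le> (1 + l) * ((1 + l) ^ card U * Z S)"
    using insert l_pos by (intro mult_left_mono) auto
  finally show ?case using insert by simp
qed simp

lemma one_plus_power_le_exp: "(1 + l) ^ k \<le> exp (l * real k)"
proof -
  have "(1 + l) ^ k \<le> exp l ^ k" using l_pos by (intro power_mono) auto
  then show ?thesis by (simp add: exp_of_nat2_mult)
qed

lemma Z_le_exp:
  assumes "finite S" shows "Z S \<le> exp (l * real (card S))"
  using Z_union_le[of "{}" S] one_plus_power_le_exp[of "card S"] assms by simp

text \<open>Restoring k deleted vertices multiplies the partition function by at most
  \<open>(1 + l) ^ k\<close>, hence by at most \<open>exp (l * k)\<close>. Divided by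
  \<open>Z S\<close>, this bounds from below the probability that \<open>U\<close> is
  unoccupied.\<close>

lemma Z_diff_ge:
  assumes "finite S"
  shows "(1 - l * real (card (S \<inter> U))) * Z S \<le> Z (S - U)"
proof -
  let ?k = "card (S \<inter> U)"
  have "Z S \<le> (1 + l) ^ ?k * Z (S - U)"
    using Z_union_le[of "S - U" "S \<inter> U"] assms by (simp add: Un_Diff_Int Un_commute)
  also have "\<dots> \<le> exp (l * real ?k) * Z (S - U)"
    using Z_pos[of "S - U"] assms by (intro mult_right_mono one_plus_power_le_exp) auto
  finally have 1: "exp (- (l * real ?k)) * Z S \<le> Z (S - U)"
    by (simp add: exp_minus field_simps)
  have "1 - l * real ?k \<le> exp (- (l * real ?k))" 
    using exp_ge_add_one_self[of "- (l * real ?k)"] by simp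
  then have "(1 - l * real ?k) * Z S \<le> exp (- (l * real ?k)) * Z S"
    using Z_pos[OF assms] by (intro mult_right_mono) auto
  with 1 show ?thesis by simp
qed

text \<open>Double counting of the pairs of an independent set and one of its members.\<close>

lemma M_eq:
  assumes "finite S" shows "M S = (\<Sum>u\<in>S. l * Z (S - cnbh u))"
proof -
  have "M S = (\<Sum>I\<in>indep S. \<Sum>u\<in>S. if u \<in> I then l ^ card I else 0)"
    unfolding M_def
  proof (intro sum.cong refl)
    fix I assume "I \<in> indep S"
    then have "S \<inter> I = I" by (auto simp: indep_def)
    then show "l ^ card I * real (card I) = (\<Sum>u\<in>S. if u \<in> I then l ^ card I else 0)"
      using assms by (simp add: sum.If_cases)
  qed
  also have "\<dots> = (\<Sum>u\<in>S. \<Sum>I\<in>indep S. if u \<in> I then l ^ card I else 0)"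
    by (rule sum.swap)
  also have "\<dots> = (\<Sum>u\<in>S. l * Z (S - cnbh u))"
  proof (intro sum.cong refl)
    fix u assume "u \<in> S"
    have "(\<Sum>I\<in>indep S. if u \<in> I then l ^ card I else 0)
      = (\<Sum>I\<in>{I\<in>indep S. u \<in> I}. l ^ card I)"
      using assms by (simp add: sum.inter_filter)
    then show "(\<Sum>I\<in>indep S. if u \<in> I then l ^ card I else 0) = l * Z (S - cnbh u)"
      using sum_indep_containing[OF assms \<open>u \<in> S\<close>] by simp
  qed
  finally show ?thesis .
qed

text \<open>By \<open>Z_diff_ge\<close>, each \<open>u\<close> is occupied with probability at least
  \<open>l * (1 - l * card (T \<inter> cnbh u))\<close>. After summation only the average closed
  degree matters, and \<open>l * K \<le> 1 / 2\<close> preserves half of the main term.\<close>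

lemma M_ge:
  assumes "finite T" "(\<Sum>u\<in>T. real (card (T \<inter> cnbh u))) \<le> K * real (card T)" "l * K \<le> 1 / 2"
  shows "l * real (card T) / 2 * Z T \<le> M T"
proof -
  have "l * (K * real (card T)) \<le> 1 / 2 * real (card T)"
    using mult_right_mono[OF assms(3), of "real (card T)"] by (simp add: mult.assoc)
  moreover have "l * (\<Sum>u\<in>T. real (card (T \<inter> cnbh u))) \<le> l * (K * real (card T))"
    using assms(2) l_pos by simp
  ultimately have "real (card T) / 2 \<le> real (card T) - l * (\<Sum>u\<in>T. real (card (T \<inter> cnbh u)))"
    by simp
  then have "l * Z T * (real (card T) / 2)
      \<le> l * Z T * (real (card T) - l * (\<Sum>u\<in>T. real (card (T \<inter> cnbh u))))"
    using Z_pos[OF assms(1)] l_pos by (intro mult_left_mono) auto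
  also have "\<dots> = (\<Sum>u\<in>T. l * ((1 - l * real (card (T \<inter> cnbh u))) * Z T))"
    by (simp add: sum_subtractf sum_distrib_left sum_distrib_right algebra_simps)
  also have "\<dots> \<le> M T" unfolding M_eq[OF assms(1)]
    using l_pos assms(1) by (intro sum_mono mult_left_mono Z_diff_ge) auto
  finally show ?thesis by (simp add: algebra_simps)
qed

text \<open>Here \<open>T\<close> is the set of neighbours of a vertex \<open>v\<close> left free by
  a fixed outside configuration; \<open>l\<close> is the weight of occupying \<open>v\<close> and
  \<open>Z T\<close> that of leaving it empty. A large \<open>T\<close> has many occupied vertices
  on average; a small \<open>T\<close> has small \<open>Z T\<close>, so \<open>v\<close> is occupied
  often enough for the reward \<open>D\<close> to pay.\<close>

lemma local_ineq:
  assumes "finite T" "(\<Sum>u\<in>T. real (card (T \<inter> cnbh u))) \<le> K * real (card T)" "l * K \<le> 1 / 2"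
    and "l \<le> 1" "0 \<le> m" "exp (4 * m) \<le> l * D"
  shows "m * (l + Z T) \<le> D * l + M T"
proof -
  have Z: "0 < Z T" using Z_pos assms by auto
  have me: "2 * m \<le> exp (2 * m)" using exp_ge_add_one_self[of "2*m"] by linarith
  have e4: "exp (4 * m) = exp (2 * m) * exp (2 * m)" by (simp flip: exp_add)
  have e1: "1 \<le> exp (2 * m)" using assms by simp
  have key: "m * (1 + exp (2 * m)) \<le> D * l"
  proof -
    have "m * (1 + exp (2 * m)) \<le> m * (2 * exp (2*m))"
      using assms e1 by (intro mult_left_mono) auto
    also have "\<dots> = 2 * m * exp (2 * m)" by simp
    also have "\<dots> \<le> exp (2*m) * exp (2*m)" using me by (intro mult_right_mono) auto
    finally show ?thesis using e4 assms by (simp add: mult.commute)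
  qed
  show ?thesis
  \<comment> \<open>From \<open>2 * m\<close> on, \<open>M_ge\<close> yields an average of
    \<open>m\<close> occupied vertices. Below it, \<open>Z T\<close> is at most
    \<open>exp (2 * m)\<close>, which is covered by \<open>key\<close>.\<close>
  proof (cases "2 * m \<le> l * real (card T)")
    case True
    have "m * Z T \<le> l * real (card T) / 2 * Z T" using True Z by (intro mult_right_mono) auto
    also have "\<dots> \<le> M T" using assms by (intro M_ge)
    finally have "m * Z T \<le> M T" .
    moreover have "m * l \<le> D * l" 
    proof -
      have "m * l \<le> m * (1 + exp (2 * m))" 
        by (intro mult_left_mono) (use assms exp_gt_zero[of "2*m"] in \<open>auto simp del: exp_gt_zero\<close>)
      then show ?thesis using key by simp
    qed
    ultimately show ?thesis by (simp add: algebra_simps)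
  next
    case False
    have "Z T \<le> exp (l * real (card T))" using assms by (intro Z_le_exp)
    also have "\<dots> \<le> exp (2 * m)" using False by simp
    finally have "m * (l + Z T) \<le> m * (1 + exp (2 * m))" using assms by (intro mult_left_mono) auto
    moreover have "0 \<le> M T" unfolding M_def using l_pos by (intro sum_nonneg) auto
    ultimately show ?thesis using key by simp
  qed
qed

text \<open>Conditioning on the part \<open>J\<close> of a random independent set outside the closed neighbourhood of
  \<open>v\<close>: what remains is either \<open>{v}\<close> or an independent subset of the neighbours of \<open>v\<close> that are not
  blocked by \<open>J\<close>.\<close>

lemma vertex_ineq:
  assumes V: "finite V" "v \<in> V"
    and K: "\<And>T. T \<subseteq> {w\<in>V. E v w} \<Longrightarrow> (\<Sum>u\<in>T. real (card (T \<inter> cnbh u))) \<le> K * real (card T)"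
    and l: "l * K \<le> 1 / 2" "l \<le> 1" "0 \<le> m" "exp (4 * m) \<le> l * D"
  shows "m * Z V \<le> (\<Sum>I\<in>indep V. l ^ card I * (D * of_bool (v \<in> I) + real (card (I \<inter> {w. E v w}))))"
proof -
  define W where "W = V - cnbh v"
  define T where "T J = {w\<in>V. E v w \<and> (\<forall>x\<in>J. \<not> E w x)}" for J
  define A where "A J = insert {v} (indep (T J))" for J
  define S where "S = (SIGMA J:indep W. A J)"
  \<comment> \<open>The reward of \<open>I\<close> as seen from \<open>v\<close>. If
    \<open>D\<close> bounds all degrees, then over all \<open>v\<close> each vertex of
    \<open>I\<close> earns \<open>D\<close> for itself and at most \<open>D\<close> through its
    neighbours.\<close>
  define wt where "wt I = D * of_bool (v \<in> I) + real (card (I \<inter> {w. E v w}))" for I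
  have finW: "finite W" and finT: "\<And>J. finite (T J)" using V by (auto simp: W_def T_def)
  have KT: "(\<Sum>u\<in>T J. real (card (T J \<inter> cnbh u))) \<le> K * real (card (T J))" for J
    by (rule K) (auto simp: T_def)
  have vT: "v \<notin> T J" for J using irrefl by (auto simp: T_def)
  have decomp: "(\<Sum>I\<in>indep V. f I) = (\<Sum>J\<in>indep W. \<Sum>B\<in>A J. f (J \<union> B))" for f :: "'a set \<Rightarrow> real"
  proof -
    have "(\<Sum>I\<in>indep V. f I) = (\<Sum>(J, B)\<in>S. f (J \<union> B))"
    proof (rule sum.reindex_bij_witness[of _ "\<lambda>(J, B). J \<union> B" "\<lambda>I. (I - cnbh v, I \<inter> cnbh v)"])
      fix I assume I: "I \<in> indep V"
      show "(I - cnbh v, I \<inter> cnbh v) \<in> S"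
      proof (cases "v \<in> I")
        case True
        then have "I \<inter> cnbh v = {v}" using I by (auto simp: indep_def cnbh_def)
        then show ?thesis using I by (auto simp: S_def A_def W_def indep_def)
      next
        case False
        then have "I \<inter> cnbh v \<in> indep (T (I - cnbh v))"
          using I by (auto simp: indep_def T_def cnbh_def)
        then show ?thesis using I by (auto simp: S_def A_def W_def indep_def)
      qed
    next
      fix x assume "x \<in> S"
      then obtain J B where x: "x = (J, B)" and J: "J \<in> indep W" and B: "B \<in> A J"
        by (auto simp: S_def)
      have Bc: "B \<subseteq> cnbh v" using B by (auto simp: A_def indep_def T_def cnbh_def)
      have Jc: "J \<inter> cnbh v = {}" using J by (auto simp: indep_def W_def)
      show "(\<lambda>I. (I - cnbh v, I \<inter> cnbh v)) (case x of (J, B) \<Rightarrow> J \<union> B) = x"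
        using Bc Jc by (auto simp: x)
      have J1: "J \<subseteq> V" and J2: "\<forall>x\<in>J. \<forall>y\<in>J. \<not> E x y"
        using J by (auto simp: indep_def W_def)
      have J3: "\<forall>x\<in>J. \<not> E v x \<and> \<not> E x v"
        using Jc sym by (auto simp: cnbh_def)
      show "(case x of (J, B) \<Rightarrow> J \<union> B) \<in> indep V"
      proof (cases "B = {v}")
        case True
        then show ?thesis using J1 J2 J3 V irrefl by (simp add: x indep_def)
      next
        case False
        then have "B \<in> indep (T J)" using B by (auto simp: A_def)
        then have "B \<subseteq> V" "\<forall>x\<in>B. \<forall>y\<in>B. \<not> E x y" "\<forall>x\<in>B. \<forall>y\<in>J. \<not> E x y \<and> \<not> E y x"
          by (auto simp: indep_def T_def dest: sym)
        then show ?thesis using J1 J2 by (auto simp: x indep_def)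
      qed
    qed (auto simp: Un_Diff_Int)
    also have "\<dots> = (\<Sum>J\<in>indep W. \<Sum>B\<in>A J. f (J \<union> B))"
      unfolding S_def using finW finT by (subst sum.Sigma) (auto simp: A_def)
    finally show ?thesis .
  qed
  \<comment> \<open>This makes the sum over \<open>A J\<close> split into the term \<open>l\<close>
    of \<open>{v}\<close> and the partition function of \<open>T J\<close>.\<close>
  have vA: "{v} \<notin> indep (T J)" for J using vT by (auto simp: indep_def)
  have fac: "l ^ card (J \<union> B) = l ^ card J * l ^ card B" "wt (J \<union> B) = wt B"
    if J: "J \<in> indep W" and B: "B \<in> A J" for J B
  proof -
    have "B \<subseteq> cnbh v" using B by (auto simp: A_def indep_def T_def cnbh_def)
    moreover have Jc: "J \<inter> cnbh v = {}" using J by (auto simp: indep_def W_def)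
    ultimately have dis: "J \<inter> B = {}" by auto
    have "finite J" "finite B" using J B finW finT by (auto simp: A_def intro: indep_finite)
    then show "l ^ card (J \<union> B) = l ^ card J * l ^ card B"
      using dis by (simp add: card_Un_disjoint power_add)
    have "(J \<union> B) \<inter> {w. E v w} = B \<inter> {w. E v w}" "v \<in> J \<union> B \<longleftrightarrow> v \<in> B"
      using Jc by (auto simp: cnbh_def)
    then show "wt (J \<union> B) = wt B" by (simp add: wt_def)
  qed
  have Zeq: "Z V = (\<Sum>J\<in>indep W. l ^ card J * (l + Z (T J)))"
    unfolding Z_def[of V] decomp
  proof (intro sum.cong refl)
    fix J assume J: "J \<in> indep W"
    have "(\<Sum>B\<in>A J. l ^ card (J \<union> B)) = (\<Sum>B\<in>A J. l ^ card J * l ^ card B)"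
      using fac J by (intro sum.cong) auto
    also have "\<dots> = l ^ card J * (l + Z (T J))"
      unfolding A_def Z_def using vA finT by (simp add: sum_distrib_left algebra_simps)
    finally show "(\<Sum>B\<in>A J. l ^ card (J \<union> B)) = l ^ card J * (l + Z (T J))" .
  qed
  have Meq: "(\<Sum>I\<in>indep V. l ^ card I * wt I) = (\<Sum>J\<in>indep W. l ^ card J * (D * l + M (T J)))"
    unfolding decomp
  proof (intro sum.cong refl)
    fix J assume J: "J \<in> indep W"
    have 1: "wt B = real (card B)" if "B \<in> indep (T J)" for B
    proof -
      have "B \<inter> {w. E v w} = B" "v \<notin> B" using that irrefl by (auto simp: indep_def T_def)
      then show ?thesis by (simp add: wt_def)
    qed
    have 2: "wt {v} = D" using irrefl by (auto simp: wt_def)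
    have "(\<Sum>B\<in>A J. l ^ card (J \<union> B) * wt (J \<union> B)) = (\<Sum>B\<in>A J. l ^ card J * (l ^ card B * wt B))"
      using fac J by (intro sum.cong) (auto simp: mult.assoc)
    also have "\<dots> = l ^ card J * (l * D + (\<Sum>B\<in>indep (T J). l ^ card B * wt B))"
      unfolding A_def using vA finT by (simp add: sum_distrib_left 2 algebra_simps)
    also have "(\<Sum>B\<in>indep (T J). l ^ card B * wt B) = M (T J)"
      unfolding M_def using 1 by (intro sum.cong) auto
    finally show "(\<Sum>B\<in>A J. l ^ card (J \<union> B) * wt (J \<union> B)) = l ^ card J * (D * l + M (T J))"
      by (simp add: mult.commute)
  qed
  have "m * Z V = (\<Sum>J\<in>indep W. l ^ card J * (m * (l + Z (T J))))"
    unfolding Zeq by (simp add: sum_distrib_left mult_ac)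
  also have "\<dots> \<le> (\<Sum>J\<in>indep W. l ^ card J * (D * l + M (T J)))"
    using l_pos l finT KT by (intro sum_mono mult_left_mono local_ineq[where K = K]) auto
  also have "\<dots> = (\<Sum>I\<in>indep V. l ^ card I * wt I)" using Meq by simp
  finally show ?thesis by (simp add: wt_def)
qed

text \<open>Each adjacent pair is counted at its endpoint that is farther with respect to \<open>d\<close>.\<close>

lemma sum_card_cnbh_le:
  fixes d :: "'a \<Rightarrow> real"
  assumes T: "finite T" and B: "\<And>u. u \<in> T \<Longrightarrow> real (card {w\<in>T \<inter> cnbh u. d w \<le> d u}) \<le> B"
  shows "(\<Sum>u\<in>T. real (card (T \<inter> cnbh u))) \<le> 2 * B * real (card T)"
proof -
  let ?f = "\<lambda>u w. of_bool (w \<in> cnbh u \<and> d w \<le> d u) :: real"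
  have count: "(\<Sum>w\<in>T. of_bool (P w)) = real (card {w\<in>T. P w})" for P
    using T by (simp add: Int_def)
  have "(\<Sum>u\<in>T. real (card (T \<inter> cnbh u))) = (\<Sum>u\<in>T. \<Sum>w\<in>T. of_bool (w \<in> cnbh u))"
    unfolding count by (simp add: Int_def)
  \<comment> \<open>Of any two vertices one is at least as far as the other, and membership in
    \<open>cnbh\<close> is symmetric.\<close>
  also have "\<dots> \<le> (\<Sum>u\<in>T. \<Sum>w\<in>T. ?f u w + ?f w u)"
    by (intro sum_mono) (auto simp: cnbh_def dest: sym)
  also have "\<dots> = (\<Sum>u\<in>T. \<Sum>w\<in>T. ?f u w) + (\<Sum>u\<in>T. \<Sum>w\<in>T. ?f w u)"
    by (simp only: sum.distrib)
  also have "(\<Sum>u\<in>T. \<Sum>w\<in>T. ?f w u) = (\<Sum>u\<in>T. \<Sum>w\<in>T. ?f u w)" by (rule sum.swap)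
  also have "(\<Sum>u\<in>T. \<Sum>w\<in>T. ?f u w) \<le> (\<Sum>u\<in>T. B)"
    using B unfolding count by (intro sum_mono) (simp add: Int_def conj_assoc)
  finally show ?thesis by (simp add: algebra_simps)
qed

text \<open>Summing \<open>vertex_ineq\<close> over all vertices shows that the expected total
  reward is at least \<open>m * card V\<close>, while each \<open>I\<close> collects at most
  \<open>2 * D * card I\<close>. Some \<open>I\<close> reaches the average.\<close>

lemma exists_large_indep:
  assumes V: "finite V" 
    and D: "\<And>v. v \<in> V \<Longrightarrow> real (card {w\<in>V. E v w}) \<le> D"
    and K: "\<And>v T. v \<in> V \<Longrightarrow> T \<subseteq> {w\<in>V. E v w} \<Longrightarrow> (\<Sum>u\<in>T. real (card (T \<inter> cnbh u))) \<le> K * real (card T)"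
    and l: "l * K \<le> 1 / 2" "l \<le> 1" "0 \<le> m" "exp (4 * m) \<le> l * D"
  shows "\<exists>I\<in>indep V. m * real (card V) \<le> 2 * D * real (card I)"
proof (rule ccontr)
  assume neg: "\<not> ?thesis"
  have "real (card V) * (m * Z V) = (\<Sum>v\<in>V. m * Z V)" by simp
  also have "\<dots> \<le> (\<Sum>v\<in>V. \<Sum>I\<in>indep V. l ^ card I * (D * of_bool (v \<in> I) + real (card (I \<inter> {w. E v w}))))"
    using assms by (intro sum_mono vertex_ineq[where K = K]) auto
  also have "\<dots> = (\<Sum>I\<in>indep V. l ^ card I * (\<Sum>v\<in>V. D * of_bool (v \<in> I) + real (card (I \<inter> {w. E v w}))))"
    by (subst sum.swap) (simp add: sum_distrib_left)
  also have "\<dots> \<le> (\<Sum>I\<in>indep V. l ^ card I * (2 * D * real (card I)))"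
  proof (intro sum_mono mult_left_mono)
    fix I assume I: "I \<in> indep V"
    then have IV: "I \<subseteq> V" and fI: "finite I" using V indep_finite by (auto simp: indep_def)
    have "(\<Sum>v\<in>V. real (card (I \<inter> {w. E v w}))) = (\<Sum>v\<in>V. \<Sum>w\<in>I. of_bool (E v w))"
      using fI by (simp add: Int_def)
    also have "\<dots> = (\<Sum>w\<in>I. \<Sum>v\<in>V. of_bool (E v w))" by (rule sum.swap)
    also have "\<dots> = (\<Sum>w\<in>I. real (card {v\<in>V. E w v}))"
      using V sym by (intro sum.cong) (auto simp: Int_def intro!: arg_cong[where f = card])
    also have "\<dots> \<le> (\<Sum>w\<in>I. D)" using D IV by (intro sum_mono) auto
    finally have 1: "(\<Sum>v\<in>V. real (card (I \<inter> {w. E v w}))) \<le> D * real (card I)"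
      by (simp add: mult.commute)
    have "(\<Sum>v\<in>V. D * of_bool (v \<in> I)) = D * real (card (V \<inter> I))"
      using V by (simp add: sum_distrib_left[symmetric] Int_def)
    also have "V \<inter> I = I" using IV by auto
    finally show "(\<Sum>v\<in>V. D * of_bool (v \<in> I) + real (card (I \<inter> {w. E v w}))) \<le> 2 * D * real (card I)"
      using 1 by (simp add: sum.distrib)
  qed (use l_pos in auto)
  \<comment> \<open>Strictness needs a nonempty family; the empty set is always independent.\<close>
  also have "\<dots> < (\<Sum>I\<in>indep V. l ^ card I * (m * real (card V)))"
    using neg V l_pos empty_indep[of V] by (intro sum_strict_mono) (auto simp: not_le simp del: empty_indep)
  also have "\<dots> = real (card V) * (m * Z V)"
    by (simp add: Z_def sum_distrib_left mult_ac)
  finally show False by simp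
qed

end

section \<open>Uniform convexity of the \<open>l\<^sub>p\<close> norm\<close>

text \<open>Strict midpoint convexity at the points 1 and \<open>t\<close>. For positive
  \<open>t\<close> the mean value theorem is applied on both sides of the midpoint, where the
  derivative is strictly larger on the right; for other \<open>t\<close> a crude bound
  suffices.\<close>

lemma convexity_gap_pos:
  fixes p t :: real
  assumes p: "1 < p" and t: "-1 \<le> t" "t < 1"
  shows "\<bar>(1 + t) / 2\<bar> powr p < (1 + \<bar>t\<bar> powr p) / 2"
proof (cases "t \<le> 0")
  case True
  have "\<bar>(1 + t) / 2\<bar> powr p \<le> (1 / 2) powr p" using True t p by (intro powr_mono2) auto
  also have "\<dots> < (1 / 2) powr 1" using p by (intro powr_less_mono') auto
  also have "\<dots> \<le> (1 + \<bar>t\<bar> powr p) / 2" by simp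
  finally show ?thesis .
next
  case False
  define m where "m = (1 + t) / 2"
  have m: "t < m" "m < 1" "0 < t" using False t by (auto simp: m_def)
  have der: "((\<lambda>x. x powr p) has_real_derivative p * x powr (p - 1)) (at x)" if "0 < x" for x
    using that by (auto intro!: derivative_eq_intros)
  obtain y where y: "t < y" "y < m" "m powr p - t powr p = (m - t) * (p * y powr (p - 1))"
    using MVT2[of t m "\<lambda>x. x powr p" "\<lambda>x. p * x powr (p - 1)"] m der by auto
  obtain z where z: "m < z" "z < 1" "1 powr p - m powr p = (1 - m) * (p * z powr (p - 1))"
    using MVT2[of m 1 "\<lambda>x. x powr p" "\<lambda>x. p * x powr (p - 1)"] m der by auto
  have "y powr (p - 1) < z powr (p - 1)" using y z m p by (intro powr_less_mono2) auto
  then have "(m - t) * (p * y powr (p - 1)) < (m - t) * (p * z powr (p - 1))"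
    using m p by (intro mult_strict_left_mono) auto
  moreover have "m - t = 1 - m" by (simp add: m_def field_simps)
  ultimately have "m powr p - t powr p < 1 - m powr p" by (metis y(3) z(3) powr_one_eq_one)
  then show ?thesis using m by (simp add: m_def)
qed

text \<open>The gap is continuous and positive away from \<open>t = 1\<close>, so compactness gives
  a positive minimum on \<open>{-1..1-\<eta>}\<close>. For \<open>t\<close> closer to 1 the bracket
  behind \<open>\<delta>\<close> is not positive and plain convexity is enough.\<close>

lemma convexity_gap_unit:
  fixes p \<eta> :: real
  assumes p: "1 < p" and \<eta>: "0 < \<eta>" "\<eta> < 1"
  shows "\<exists>\<delta>>0. \<forall>t. \<bar>t\<bar> \<le> 1 \<longrightarrow> \<bar>(1 + t) / 2\<bar> powr p
    \<le> (1 + \<bar>t\<bar> powr p) / 2 - \<delta> * (\<bar>1 - t\<bar> powr p - \<eta> powr p * (1 + \<bar>t\<bar> powr p))"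
proof -
  let ?g = "\<lambda>t. (1 + \<bar>t\<bar> powr p) / 2 - \<bar>(1 + t) / 2\<bar> powr p"
  have "continuous_on {-1..1-\<eta>} ?g" using p by (intro continuous_intros continuous_on_powr') auto
  then obtain t0 where t0: "t0 \<in> {-1..1-\<eta>}" "\<And>t. t \<in> {-1..1-\<eta>} \<Longrightarrow> ?g t0 \<le> ?g t"
    using continuous_attains_inf[of "{-1..1-\<eta>}" ?g] \<eta> by auto
  have g0: "0 < ?g t0" using convexity_gap_pos[OF p, of t0] t0 \<eta> by auto
  \<comment> \<open>The bracket never exceeds \<open>2 powr p\<close>, so this
    \<open>\<delta>\<close> keeps the subtracted term below the minimal gap.\<close>
  define \<delta> where "\<delta> = ?g t0 / 2 powr p"
  have \<delta>: "0 < \<delta>" using g0 by (simp add: \<delta>_def)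
  show ?thesis
  proof (intro exI[of _ \<delta>] conjI allI impI)
    fix t :: real assume t: "\<bar>t\<bar> \<le> 1"
    show "\<bar>(1 + t) / 2\<bar> powr p
      \<le> (1 + \<bar>t\<bar> powr p) / 2 - \<delta> * (\<bar>1 - t\<bar> powr p - \<eta> powr p * (1 + \<bar>t\<bar> powr p))"
    proof (cases "t \<le> 1 - \<eta>")
      case True
      have "\<bar>1 - t\<bar> powr p \<le> 2 powr p" using t p by (intro powr_mono2) auto
      then have "\<bar>1 - t\<bar> powr p - \<eta> powr p * (1 + \<bar>t\<bar> powr p) \<le> 2 powr p"
        by (smt (verit) powr_ge_zero mult_nonneg_nonneg)
      then have "\<delta> * (\<bar>1 - t\<bar> powr p - \<eta> powr p * (1 + \<bar>t\<bar> powr p)) \<le> \<delta> * 2 powr p"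
        using \<delta> by (intro mult_left_mono) auto
      also have "\<dots> = ?g t0" by (simp add: \<delta>_def)
      also have "\<dots> \<le> ?g t" using t0 True t by auto
      finally show ?thesis by simp
    next
      case False
      have 1: "\<bar>1 - t\<bar> powr p \<le> \<eta> powr p" using False t p by (intro powr_mono2) auto
      have "\<eta> powr p * 1 \<le> \<eta> powr p * (1 + \<bar>t\<bar> powr p)" by (intro mult_left_mono) auto
      with 1 have "\<delta> * (\<bar>1 - t\<bar> powr p - \<eta> powr p * (1 + \<bar>t\<bar> powr p)) \<le> 0"
        using \<delta> by (intro mult_nonneg_nonpos) auto
      moreover have "0 \<le> ?g t"
      proof (cases "t = 1")
        case False
        with t have "-1 \<le> t" "t < 1" by auto
        from convexity_gap_pos[OF p this] show ?thesis by simp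
      qed simp
      ultimately show ?thesis by linarith
    qed
  qed (use \<delta> in auto)
qed

text \<open>The term \<open>\<eta> powr p\<close> absorbs pairs with \<open>s\<close> close to \<open>t\<close>, which lets the gap be summed over coordinates
  with a constant independent of the dimension.\<close>

lemma convexity_gap:
  fixes p \<eta> :: real
  assumes p: "1 < p" and \<eta>: "0 < \<eta>" "\<eta> < 1"
  shows "\<exists>\<delta>>0. \<forall>s t. \<bar>(s + t) / 2\<bar> powr p
    \<le> (\<bar>s\<bar> powr p + \<bar>t\<bar> powr p) / 2
       - \<delta> * (\<bar>s - t\<bar> powr p - \<eta> powr p * (\<bar>s\<bar> powr p + \<bar>t\<bar> powr p))"
proof -
  obtain \<delta> where \<delta>: "0 < \<delta>" and gap: "\<And>t. \<bar>t\<bar> \<le> 1 \<Longrightarrow> \<bar>(1 + t) / 2\<bar> powr p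
    \<le> (1 + \<bar>t\<bar> powr p) / 2 - \<delta> * (\<bar>1 - t\<bar> powr p - \<eta> powr p * (1 + \<bar>t\<bar> powr p))"
    using convexity_gap_unit[OF assms] by blast
  let ?P = "\<lambda>s t. \<bar>(s + t) / 2\<bar> powr p
    \<le> (\<bar>s\<bar> powr p + \<bar>t\<bar> powr p) / 2
       - \<delta> * (\<bar>s - t\<bar> powr p - \<eta> powr p * (\<bar>s\<bar> powr p + \<bar>t\<bar> powr p))"
  \<comment> \<open>Both sides are homogeneous of degree \<open>p\<close>, so dividing by the larger
    entry reduces to the normalised case.\<close>
  have main: "?P s t" if st: "\<bar>t\<bar> \<le> \<bar>s\<bar>" for s t
  proof (cases "s = 0")
    case True
    then show ?thesis using st p by simp
  next
    case False
    define u where "u = t / s"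
    have u: "\<bar>u\<bar> \<le> 1" and t: "t = s * u" using st False by (auto simp: u_def divide_simps)
    have e: "(s + s * u) / 2 = s * ((1 + u) / 2)" "s - s * u = s * (1 - u)"
      by (auto simp: algebra_simps)
    have "\<bar>s\<bar> powr p * \<bar>(1 + u) / 2\<bar> powr p \<le> \<bar>s\<bar> powr p * ((1 + \<bar>u\<bar> powr p) / 2
        - \<delta> * (\<bar>1 - u\<bar> powr p - \<eta> powr p * (1 + \<bar>u\<bar> powr p)))"
      using gap[OF u] by (intro mult_left_mono) auto
    then show ?thesis unfolding t e abs_mult[of s] powr_mult[of "\<bar>s\<bar>"]
      by (simp add: algebra_simps)
  qed
  have "?P s t" for s t
  proof (cases "\<bar>t\<bar> \<le> \<bar>s\<bar>")
    case False
    then show ?thesis using main[of s t] by (simp add: add.commute abs_minus_commute)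
  qed (use main in auto)
  with \<delta> show ?thesis by blast
qed

section \<open>The l_p norm and Minkowski's inequality\<close>

definition lpn :: "real \<Rightarrow> nat \<Rightarrow> (nat \<Rightarrow> real) \<Rightarrow> real" where
  "lpn p n x = (\<Sum>j<n. \<bar>x j\<bar> powr p) powr (1 / p)"

lemma lpn_nonneg [simp]: "0 \<le> lpn p n x"
  by (simp add: lpn_def)

lemma lpn_powr: "1 \<le> p \<Longrightarrow> lpn p n x powr p = (\<Sum>j<n. \<bar>x j\<bar> powr p)"
  by (simp add: lpn_def powr_powr sum_nonneg)

lemma lpn_le_iff:
  assumes "1 \<le> p" "0 \<le> r"
  shows "lpn p n x \<le> r \<longleftrightarrow> (\<Sum>j<n. \<bar>x j\<bar> powr p) \<le> r powr p"
  using assms powr_mono2[of p "lpn p n x" r] powr_less_mono2[of p r "lpn p n x"]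
  by (auto simp: not_le simp flip: lpn_powr intro: leI)

lemma lpn_mult:
  assumes "1 \<le> p" shows "lpn p n (\<lambda>j. c * x j) = \<bar>c\<bar> * lpn p n x"
proof -
  have "(\<Sum>j<n. \<bar>c * x j\<bar> powr p) = \<bar>c\<bar> powr p * (\<Sum>j<n. \<bar>x j\<bar> powr p)"
    by (simp add: abs_mult powr_mult sum_distrib_left)
  then show ?thesis using assms
    by (simp add: lpn_def powr_mult sum_nonneg powr_powr)
qed

lemma lpn_minus_commute: "lpn p n (\<lambda>j. x j - y j) = lpn p n (\<lambda>j. y j - x j)"
  by (simp add: lpn_def abs_minus_commute)

lemma abs_le_lpn:
  assumes "1 \<le> p" "j < n" shows "\<bar>x j\<bar> \<le> lpn p n x"
proof -
  have "\<bar>x j\<bar> powr p \<le> (\<Sum>j<n. \<bar>x j\<bar> powr p)"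
    using assms by (intro member_le_sum) auto
  then have "(\<bar>x j\<bar> powr p) powr (1 / p) \<le> lpn p n x"
    unfolding lpn_def using assms by (intro powr_mono2) auto
  then show ?thesis using assms by (simp add: powr_powr)
qed

text \<open>The factor \<open>n\<close> is cruder than \<open>n powr (1 / p)\<close> but does not
  depend on \<open>p\<close>; a fine enough mesh makes it harmless.\<close>

lemma lpn_le_box:
  assumes "1 \<le> p" "1 \<le> n" "0 \<le> h" "\<And>j. j < n \<Longrightarrow> \<bar>x j\<bar> \<le> h"
  shows "lpn p n x \<le> real n * h"
proof (subst lpn_le_iff)
  have "(\<Sum>j<n. \<bar>x j\<bar> powr p) \<le> (\<Sum>j<n. h powr p)"
    using assms by (intro sum_mono powr_mono2) auto
  also have "\<dots> = real n powr 1 * h powr p" by simp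
  also have "\<dots> \<le> real n powr p * h powr p" using assms by (intro mult_right_mono powr_mono) auto
  also have "\<dots> = (real n * h) powr p" using assms by (simp add: powr_mult)
  finally show "(\<Sum>j<n. \<bar>x j\<bar> powr p) \<le> (real n * h) powr p" .
qed (use assms in auto)

text \<open>Extends convexity from the positive reals to 0, since coordinates may vanish; at 0 it
  reduces to \<open>t powr p \<le> t\<close> on the unit interval.\<close>

lemma powr_convex_nonneg:
  assumes "1 \<le> p" shows "convex_on {0..} (\<lambda>x::real. x powr p)"
proof (rule convex_onI)
  fix t x y :: real assume t: "0 < t" "t < 1" and x: "x \<in> {0..}" and y: "y \<in> {0..}"
  have small: "s powr p \<le> s" if "0 < s" "s < 1" for s :: real
    using powr_mono'[of 1 p s] assms that by simp
  show "((1 - t) *\<^sub>R x + t *\<^sub>R y) powr p \<le> (1 - t) * x powr p + t * y powr p"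
  proof (cases "x = 0 \<or> y = 0")
    case True
    then show ?thesis using t x y assms small[of t] small[of "1 - t"]
      by (auto simp: powr_mult intro!: mult_right_mono)
  next
    case False
    then show ?thesis
      using convex_onD[OF powr_convex[OF assms], of t x y] t x y by auto
  qed
qed (auto simp: convex_real_interval)

lemma lpn_eq_0: "1 \<le> p \<Longrightarrow> lpn p n x = 0 \<Longrightarrow> j < n \<Longrightarrow> x j = 0"
  using abs_le_lpn[of p j n x] by simp

lemma lpn_triangle:
  assumes p: "1 \<le> p"
  shows "lpn p n (\<lambda>j. x j + y j) \<le> lpn p n x + lpn p n y"
proof -
  let ?A = "lpn p n x" and ?B = "lpn p n y"
  consider "?A = 0" | "?B = 0" | "0 < ?A" "0 < ?B"
    using lpn_nonneg[of p n x] lpn_nonneg[of p n y] by linarith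
  then show ?thesis
  proof cases
    case 1
    then have "lpn p n (\<lambda>j. x j + y j) = ?B" using lpn_eq_0[OF p 1] by (simp add: lpn_def)
    then show ?thesis by simp
  next
    case 2
    then have "lpn p n (\<lambda>j. x j + y j) = ?A" using lpn_eq_0[OF p 2] by (simp add: lpn_def)
    then show ?thesis by simp
  next
    case 3
    \<comment> \<open>With this weight, the sum divided by \<open>?A + ?B\<close> is a convex
      combination of the two normalised vectors, and convexity of the power applies in each
      coordinate.\<close>
    define t where "t = ?B / (?A + ?B)"
    have t: "0 \<le> t" "t \<le> 1" "1 - t = ?A / (?A + ?B)" using 3 by (auto simp: t_def field_simps)
    have "\<bar>x j + y j\<bar> powr p \<le> (?A + ?B) powr p *
        ((1 - t) * (\<bar>x j\<bar> / ?A) powr p + t * (\<bar>y j\<bar> / ?B) powr p)" for j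
    proof -
      have "\<bar>x j + y j\<bar> powr p \<le> (\<bar>x j\<bar> + \<bar>y j\<bar>) powr p" using p by (intro powr_mono2) auto
      also have "\<bar>x j\<bar> + \<bar>y j\<bar> = (?A + ?B) * ((1 - t) * (\<bar>x j\<bar> / ?A) + t * (\<bar>y j\<bar> / ?B))"
      proof -
        have "(?A + ?B) * (1 - t) = ?A" "(?A + ?B) * t = ?B" 
          unfolding t(3) using 3 by (auto simp: t_def)
        moreover have "(?A + ?B) * ((1 - t) * (\<bar>x j\<bar> / ?A) + t * (\<bar>y j\<bar> / ?B))
          = ((?A + ?B) * (1 - t)) * (\<bar>x j\<bar> / ?A) + ((?A + ?B) * t) * (\<bar>y j\<bar> / ?B)"
          by (simp only: distrib_left mult.assoc)
        ultimately show ?thesis using 3 by simp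
      qed
      also have "\<dots> powr p = (?A + ?B) powr p * ((1 - t) * (\<bar>x j\<bar> / ?A) + t * (\<bar>y j\<bar> / ?B)) powr p"
        by (rule powr_mult)
      also have "\<dots> \<le> (?A + ?B) powr p *
        ((1 - t) * (\<bar>x j\<bar> / ?A) powr p + t * (\<bar>y j\<bar> / ?B) powr p)"
        using convex_onD[OF powr_convex_nonneg[OF p], of t "\<bar>x j\<bar> / ?A" "\<bar>y j\<bar> / ?B"] t
        by (intro mult_left_mono) auto
      finally show ?thesis .
    qed
    then have "(\<Sum>j<n. \<bar>x j + y j\<bar> powr p) \<le> (\<Sum>j<n. (?A + ?B) powr p *
        ((1 - t) * (\<bar>x j\<bar> / ?A) powr p + t * (\<bar>y j\<bar> / ?B) powr p))"
      by (intro sum_mono)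
    also have "\<dots> = (?A + ?B) powr p * ((1 - t) * ((\<Sum>j<n. \<bar>x j\<bar> powr p) / ?A powr p)
        + t * ((\<Sum>j<n. \<bar>y j\<bar> powr p) / ?B powr p))"
      by (simp add: powr_divide sum.distrib flip: sum_distrib_left sum_divide_distrib)
    also have "\<dots> = (?A + ?B) powr p" using 3 by (simp flip: lpn_powr[OF p])
    finally show ?thesis using p by (subst lpn_le_iff) auto
  qed
qed

section \<open>Dimension-free uniform convexity and lenses\<close>

lemma lpn_uniformly_convex:
  assumes p: "1 < p" "p \<le> 2"
  shows "\<exists>\<theta><1. 0 < \<theta> \<and> (\<forall>n x y. lpn p n x \<le> 1 \<longrightarrow> lpn p n y \<le> 1 \<longrightarrow>
    1 / 2 \<le> lpn p n (\<lambda>j. x j - y j) \<longrightarrow> lpn p n (\<lambda>j. (x j + y j) / 2) \<le> \<theta>)"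
proof -
  define q :: real where "q = (1 / 2) powr p"
  \<comment> \<open>The value 1/8 makes the error term, at most \<open>2 * (1 / 8) powr p\<close> in
    total, no more than half of the separation \<open>(1 / 2) powr p\<close>.\<close>
  obtain \<delta> where \<delta>: "0 < \<delta>" and gap: "\<And>s t. \<bar>(s + t) / 2\<bar> powr p
    \<le> (\<bar>s\<bar> powr p + \<bar>t\<bar> powr p) / 2
       - \<delta> * (\<bar>s - t\<bar> powr p - (1 / 8) powr p * (\<bar>s\<bar> powr p + \<bar>t\<bar> powr p))"
    using convexity_gap[OF p(1), of "1 / 8"] by auto
  have q0: "0 < q" by (simp add: q_def)
  have q: "2 * (1 / 8) powr p \<le> q / 2"
  proof -
    have "(1 / 8 :: real) powr p = q * (1 / 4) powr p"
      by (simp add: q_def flip: powr_mult)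
    also have "(1 / 4 :: real) powr p \<le> (1 / 4) powr 1" using p by (intro powr_mono') auto
    finally show ?thesis using q0 by simp
  qed
  \<comment> \<open>The cap 1/2 only keeps \<open>1 - e\<close> positive.\<close>
  define e where "e = min (1 / 2) (\<delta> * (q / 2))"
  have e: "0 < e" "e < 1" "e \<le> \<delta> * (q / 2)" using \<delta> q0 by (auto simp: e_def)
  define \<theta> where "\<theta> = (1 - e) powr (1 / p)"
  have \<theta>: "0 < \<theta>" "\<theta> < 1"
    using e p powr_less_mono2[of "1 / p" "1 - e" 1] by (auto simp: \<theta>_def)
  have \<theta>p: "\<theta> powr p = 1 - e" using p e by (simp add: \<theta>_def powr_powr)
  show ?thesis
  proof (intro exI[of _ \<theta>] conjI allI impI)
    fix n and x y :: "nat \<Rightarrow> real"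
    assume x: "lpn p n x \<le> 1" and y: "lpn p n y \<le> 1" and xy: "1 / 2 \<le> lpn p n (\<lambda>j. x j - y j)"
    let ?X = "\<Sum>j<n. \<bar>x j\<bar> powr p" and ?Y = "\<Sum>j<n. \<bar>y j\<bar> powr p"
    have XY: "?X \<le> 1" "?Y \<le> 1" using x y p lpn_le_iff[of p 1 n] by auto
    have "q \<le> lpn p n (\<lambda>j. x j - y j) powr p"
      unfolding q_def using xy p by (intro powr_mono2) auto
    then have D: "q \<le> (\<Sum>j<n. \<bar>x j - y j\<bar> powr p)" using p by (simp add: lpn_powr)
    have "(1 / 8) powr p * (?X + ?Y) \<le> (1 / 8) powr p * 2" using XY by (intro mult_left_mono) auto
    with q D have ge: "q / 2 \<le> (\<Sum>j<n. \<bar>x j - y j\<bar> powr p) - (1 / 8) powr p * (?X + ?Y)" by linarith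
    have "(\<Sum>j<n. \<bar>(x j + y j) / 2\<bar> powr p) \<le> (\<Sum>j<n. (\<bar>x j\<bar> powr p + \<bar>y j\<bar> powr p) / 2
       - \<delta> * (\<bar>x j - y j\<bar> powr p - (1 / 8) powr p * (\<bar>x j\<bar> powr p + \<bar>y j\<bar> powr p)))"
      by (intro sum_mono gap)
    also have "\<dots> = (?X + ?Y) / 2 - \<delta> * ((\<Sum>j<n. \<bar>x j - y j\<bar> powr p) - (1 / 8) powr p * (?X + ?Y))"
      by (simp add: sum_subtractf sum.distrib flip: sum_distrib_left sum_divide_distrib)
    also have "\<dots> \<le> 1 - \<delta> * (q / 2)"
      using XY by (intro diff_mono mult_left_mono[OF ge less_imp_le[OF \<delta>]]) simp
    also have "\<dots> \<le> \<theta> powr p" using e \<theta>p by simp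
    finally show "lpn p n (\<lambda>j. (x j + y j) / 2) \<le> \<theta>"
      using p \<theta> by (subst lpn_le_iff) auto
  qed (use \<theta> in auto)
qed

text \<open>The centre is \<open>u / 2\<close>: the vector \<open>y - u / 2\<close> is the midpoint
  of \<open>y\<close> and \<open>y - u\<close>, which have norm at most \<open>s\<close> and differ
  by \<open>u\<close>. Uniform convexity applies if \<open>u\<close> is long; if it is short, the
  lens already lies in the ball of radius \<open>s / 2\<close> about 0. That \<open>\<theta>\<close>
  is independent of \<open>n\<close> makes the volume saving exponential.\<close>

lemma lens_in_ball:
  assumes p: "1 < p" "p \<le> 2"
  shows "\<exists>\<theta><1. 0 < \<theta> \<and> (\<forall>n u s. 0 < s \<longrightarrow> lpn p n u \<le> s \<longrightarrow>
    (\<exists>a. \<forall>y. lpn p n y \<le> lpn p n u \<longrightarrow> lpn p n (\<lambda>j. y j - u j) \<le> s \<longrightarrow> lpn p n (\<lambda>j. y j - a j) \<le> \<theta> * s))"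
proof -
  obtain \<theta> where \<theta>: "0 < \<theta>" "\<theta> < 1" and uc: "\<And>n x y. lpn p n x \<le> 1 \<Longrightarrow> lpn p n y \<le> 1 \<Longrightarrow>
    1 / 2 \<le> lpn p n (\<lambda>j. x j - y j) \<Longrightarrow> lpn p n (\<lambda>j. (x j + y j) / 2) \<le> \<theta>"
    using lpn_uniformly_convex[OF p] by blast
  show ?thesis
  proof (intro exI[of _ "max \<theta> (1 / 2)"] conjI allI impI)
    fix n and u :: "nat \<Rightarrow> real" and s :: real
    assume s: "0 < s" and u: "lpn p n u \<le> s"
    have scale: "lpn p n (\<lambda>j. x j / s) = lpn p n x / s" for x
      using lpn_mult[of p n "1 / s" x] p s by simp
    show "\<exists>a. \<forall>y. lpn p n y \<le> lpn p n u \<longrightarrow> lpn p n (\<lambda>j. y j - u j) \<le> s \<longrightarrow>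
      lpn p n (\<lambda>j. y j - a j) \<le> max \<theta> (1 / 2) * s"
    proof (cases "lpn p n u \<le> s / 2")
      case True
      have "s / 2 \<le> max \<theta> (1 / 2) * s" using s by (simp add: mult_right_mono max_def)
      then show ?thesis using True by (intro exI[of _ "\<lambda>_. 0"]) auto
    next
      case False
      show ?thesis
      proof (intro exI[of _ "\<lambda>j. u j / 2"] allI impI)
        fix y assume y: "lpn p n y \<le> lpn p n u" "lpn p n (\<lambda>j. y j - u j) \<le> s"
        have "lpn p n (\<lambda>j. (y j / s + (y j - u j) / s) / 2) \<le> \<theta>"
        proof (rule uc)
          show "lpn p n (\<lambda>j. y j / s) \<le> 1" using y u s by (simp add: scale)
          show "lpn p n (\<lambda>j. (y j - u j) / s) \<le> 1" using y s by (simp add: scale)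
          have "(\<lambda>j. y j / s - (y j - u j) / s) = (\<lambda>j. u j / s)" by (simp add: diff_divide_distrib)
          then show "1 / 2 \<le> lpn p n (\<lambda>j. y j / s - (y j - u j) / s)"
            using False s by (simp add: scale field_simps)
        qed
        also have "(\<lambda>j. (y j / s + (y j - u j) / s) / 2) = (\<lambda>j. (y j - u j / 2) / s)"
          using s by (auto simp: field_simps)
        finally have "lpn p n (\<lambda>j. y j - u j / 2) \<le> \<theta> * s" unfolding scale using s by (simp only: pos_divide_le_eq)
        also have "\<dots> \<le> max \<theta> (1 / 2) * s" using s by (intro mult_right_mono) auto
        finally show "lpn p n (\<lambda>j. y j - u j / 2) \<le> max \<theta> (1 / 2) * s" .
      qed
    qed
  qed (use \<theta> in auto)
qed

section \<open>Volumes of balls and counting grid points\<close>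

lemma lp_dist_eq: "lp_dist p n x y = lpn p n (\<lambda>j. x j - y j)"
  by (simp add: lp_dist_def lpn_def)

lemma space_lebn: "space (lebn n) = Rn n"
  by (simp add: lebn_def Rn_def space_PiM)

lemma borel_measurable_lp_dist [measurable]: "lp_dist p n x \<in> borel_measurable (lebn n)"
  unfolding lp_dist_def[abs_def] lebn_def by measurable

lemma sets_lp_ball [measurable]: "lp_ball p n x r \<in> sets (lebn n)"
proof -
  have "lp_ball p n x r = {y \<in> space (lebn n). lp_dist p n x y \<le> r}"
    by (auto simp: lp_ball_def space_lebn)
  then show ?thesis by simp
qed

lemma sets_box: "(\<And>i. i < n \<Longrightarrow> A i \<in> sets borel) \<Longrightarrow> PiE {..<n} A \<in> sets (lebn n)"
  unfolding lebn_def by (rule sets_PiM_I_finite) auto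

lemma emeasure_box:
  assumes "\<And>i. i < n \<Longrightarrow> A i \<in> sets borel"
  shows "emeasure (lebn n) (PiE {..<n} A) = (\<Prod>i<n. emeasure lborel (A i))"
proof -
  interpret product_sigma_finite "\<lambda>_::nat. lborel :: real measure" by standard
  show ?thesis unfolding lebn_def using assms by (intro emeasure_PiM) auto
qed

text \<open>The scaled push-forward agrees with the product measure on boxes, by the one-dimensional
  affine rule in each coordinate, and boxes determine the product measure.\<close>

lemma emeasure_lebn_affine:
  assumes c: "0 < c" and A: "A \<in> sets (lebn n)"
  shows "emeasure (lebn n) A
    = ennreal (c ^ n) * emeasure (lebn n) ((\<lambda>y. \<lambda>i\<in>{..<n}. a i + c * y i) -` A \<inter> Rn n)"
proof -
  let ?f = "\<lambda>y. \<lambda>i\<in>{..<n}. a i + c * y i"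
  interpret product_sigma_finite "\<lambda>_::nat. lborel :: real measure" by standard
  have f[measurable]: "?f \<in> lebn n \<rightarrow>\<^sub>M lebn n"
    unfolding lebn_def by measurable
  have "scale_measure (ennreal (c ^ n)) (distr (lebn n) (lebn n) ?f) = PiM {..<n} (\<lambda>_. lborel)"
  proof (rule PiM_eqI)
    fix A :: "nat \<Rightarrow> real set" assume A: "\<And>i. i \<in> {..<n} \<Longrightarrow> A i \<in> sets lborel"
    let ?B = "\<lambda>i. (\<lambda>x. a i + c * x) -` A i"
    have B: "?B i \<in> sets borel" if "i < n" for i
      using measurable_sets[of "\<lambda>x. a i + c * x" borel borel "A i"] A[of i] that by simp
    have pre: "?f -` PiE {..<n} A \<inter> Rn n = PiE {..<n} ?B"
      by (auto simp: Rn_def PiE_iff extensional_def restrict_def)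
    have "emeasure (scale_measure (ennreal (c ^ n)) (distr (lebn n) (lebn n) ?f)) (PiE {..<n} A)
      = ennreal (c ^ n) * emeasure (lebn n) (PiE {..<n} ?B)"
      using A by (simp add: emeasure_distr sets_box space_lebn pre)
    also have "\<dots> = (\<Prod>i<n. ennreal c * emeasure lborel (?B i))"
      using B c by (simp add: emeasure_box prod.distrib ennreal_power)
    also have "\<dots> = (\<Prod>i<n. emeasure lborel (A i))"
    proof (intro prod.cong refl)
      fix i assume i: "i \<in> {..<n}"
      have "emeasure lborel (A i)
        = emeasure (density (distr lborel borel (\<lambda>x. a i + c * x)) (\<lambda>_. ennreal \<bar>c\<bar>)) (A i)"
        using c by (subst lborel_real_affine[of c "a i"]) auto
      also have "\<dots> = ennreal c * emeasure lborel (?B i)"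
        using A[OF i] c by (simp add: emeasure_density nn_integral_cmult_indicator emeasure_distr)
      finally show "ennreal c * emeasure lborel (?B i) = emeasure lborel (A i)" by simp
    qed
    finally show "emeasure (scale_measure (ennreal (c ^ n)) (distr (lebn n) (lebn n) ?f)) (PiE {..<n} A)
      = (\<Prod>i\<in>{..<n}. emeasure lborel (A i))" .
  qed (simp_all add: lebn_def)
  then have "emeasure (lebn n) A = emeasure (scale_measure (ennreal (c ^ n)) (distr (lebn n) (lebn n) ?f)) A"
    by (simp add: lebn_def)
  also have "\<dots> = ennreal (c ^ n) * emeasure (lebn n) (?f -` A \<inter> Rn n)"
    using A by (simp add: emeasure_distr space_lebn)
  finally show ?thesis .
qed

lemma emeasure_lp_ball:
  assumes p: "1 \<le> p" and r: "0 < r"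
  shows "emeasure (lebn n) (lp_ball p n a r) = ennreal (r ^ n) * emeasure (lebn n) (lp_ball p n (\<lambda>_. 0) 1)"
proof -
  have dist: "lp_dist p n a (\<lambda>i\<in>{..<n}. a i + r * y i) = r * lp_dist p n (\<lambda>_. 0) y" for y
  proof -
    have "lp_dist p n a (\<lambda>i\<in>{..<n}. a i + r * y i) = lpn p n (\<lambda>j. r * (0 - y j))"
      by (simp add: lp_dist_eq lpn_def)
    then show ?thesis using r p unfolding lp_dist_eq by (subst (asm) lpn_mult) auto
  qed
  have "(\<lambda>y. \<lambda>i\<in>{..<n}. a i + r * y i) -` lp_ball p n a r \<inter> Rn n = lp_ball p n (\<lambda>_. 0) 1"
    using r by (auto simp: lp_ball_def dist Rn_def)
  then show ?thesis using emeasure_lebn_affine[OF r sets_lp_ball, where a = a] by simp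
qed

definition vol1 :: "real \<Rightarrow> nat \<Rightarrow> real" where
  "vol1 p n = measure (lebn n) (lp_ball p n (\<lambda>_. 0) 1)"

text \<open>The unit ball lies between the cubes with sides \<open>{0..1 / n}\<close> and
  \<open>{-1..1}\<close>, so its volume is positive and finite.\<close>

lemma emeasure_unit_lp_ball:
  assumes p: "1 \<le> p" and n: "1 \<le> n"
  shows "emeasure (lebn n) (lp_ball p n (\<lambda>_. 0) 1) = ennreal (vol1 p n)" "0 < vol1 p n"
proof -
  let ?U = "lp_ball p n (\<lambda>_. 0) 1"
  have "?U \<subseteq> PiE {..<n} (\<lambda>_. {-1..1})"
  proof
    fix y assume y: "y \<in> ?U"
    have y1: "\<bar>y j\<bar> \<le> 1" if "j < n" for j
      using abs_le_lpn[OF p that, of y] y lpn_minus_commute[of p n "\<lambda>_. 0" y]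
      by (simp add: lp_ball_def lp_dist_eq)
    then show "y \<in> PiE {..<n} (\<lambda>_. {-1..1})" using y y1 by (simp add: lp_ball_def Rn_def PiE_iff abs_le_iff minus_le_iff)
  qed
  then have "emeasure (lebn n) ?U \<le> emeasure (lebn n) (PiE {..<n} (\<lambda>_. {-1..1}))"
    by (intro emeasure_mono sets_box) auto
  also have "\<dots> < \<infinity>" by (subst emeasure_box) (auto simp: ennreal_power power_less_top_ennreal)
  finally have fin: "emeasure (lebn n) ?U < \<infinity>" .
  then show eq: "emeasure (lebn n) ?U = ennreal (vol1 p n)"
    by (simp add: vol1_def emeasure_eq_ennreal_measure)
  have "PiE {..<n} (\<lambda>_. {0..1 / real n}) \<subseteq> ?U"
  proof
    fix y assume y: "y \<in> PiE {..<n} (\<lambda>_. {0..1 / real n})"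
    have "lpn p n y \<le> real n * (1 / real n)"
      using y p n by (intro lpn_le_box) (auto simp: PiE_iff)
    then show "y \<in> ?U" using y n lpn_minus_commute[of p n "\<lambda>_. 0" y]
      by (auto simp: lp_ball_def lp_dist_eq Rn_def PiE_iff)
  qed
  then have "emeasure (lebn n) (PiE {..<n} (\<lambda>_. {0..1 / real n})) \<le> ennreal (vol1 p n)"
    unfolding eq[symmetric] by (intro emeasure_mono) auto
  moreover have "0 < emeasure (lebn n) (PiE {..<n} (\<lambda>_. {0..1 / real n}))"
    using n by (subst emeasure_box) (auto simp: ennreal_power)
  ultimately have "0 < ennreal (vol1 p n)" by order
  then show "0 < vol1 p n" by simp
qed

lemma measure_lp_ball:
  assumes "1 \<le> p" "1 \<le> n" "0 < r"
  shows "lp_ball p n a r \<in> fmeasurable (lebn n)" "measure (lebn n) (lp_ball p n a r) = r ^ n * vol1 p n"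
proof -
  have e: "emeasure (lebn n) (lp_ball p n a r) = ennreal (r ^ n * vol1 p n)"
    using emeasure_lp_ball[OF assms(1,3), of n a] emeasure_unit_lp_ball[OF assms(1,2)] assms(3)
    by (simp add: ennreal_mult)
  then show "lp_ball p n a r \<in> fmeasurable (lebn n)" by (intro fmeasurableI) auto
  show "measure (lebn n) (lp_ball p n a r) = r ^ n * vol1 p n"
    using e assms emeasure_unit_lp_ball[of p n] by (simp add: measure_def)
qed

text \<open>By scaling, the description in the definition has exactly one solution, the
  \<open>n\<close>-th root of \<open>1 / vol1 p n\<close>.\<close>

lemma unit_vol_radius:
  assumes "1 \<le> p" "1 \<le> n"
  shows "0 < unit_vol_radius p n" "unit_vol_radius p n ^ n * vol1 p n = 1"
proof -
  let ?P = "\<lambda>r. 0 < r \<and> measure (lebn n) (lp_ball p n (\<lambda>_. 0) r) = 1"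
  define V where "V = vol1 p n"
  have V: "0 < V" using emeasure_unit_lp_ball assms by (simp add: V_def)
  have P_iff: "?P r \<longleftrightarrow> 0 < r \<and> r ^ n = 1 / V" for r
    using measure_lp_ball(2)[OF assms, of r "\<lambda>_. 0"] V by (auto simp: V_def field_simps)
  have "\<exists>!r. ?P r" unfolding P_iff
  proof (intro ex1I[of _ "root n (1 / V)"] conjI)
    show "r = root n (1 / V)" if "0 < r \<and> r ^ n = 1 / V" for r
      using that assms by (metis One_nat_def less_eq_real_def less_le_trans real_root_power_cancel zero_less_one)
  qed (use V assms in auto)
  then have "?P (unit_vol_radius p n)" unfolding unit_vol_radius_def by (rule theI')
  then show "0 < unit_vol_radius p n" "unit_vol_radius p n ^ n * vol1 p n = 1"
    using V by (simp_all add: P_iff flip: V_def)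
qed

section \<open>Grid points counted by the volume of their cells\<close>

definition grid :: "nat \<Rightarrow> real \<Rightarrow> (nat \<Rightarrow> real) set" where
  "grid n h = {x \<in> Rn n. \<forall>i<n. \<exists>k::int. x i = h * of_int k}"

text \<open>Half-open sides make the cells of distinct grid points disjoint while the cells still
  cover the space.\<close>

definition cell :: "nat \<Rightarrow> real \<Rightarrow> (nat \<Rightarrow> real) \<Rightarrow> (nat \<Rightarrow> real) set" where
  "cell n h x = PiE {..<n} (\<lambda>i. {x i..<x i + h})"

lemma emeasure_cell: "0 \<le> h \<Longrightarrow> emeasure (lebn n) (cell n h x) = ennreal (h ^ n)"
  unfolding cell_def by (subst emeasure_box) (auto simp: ennreal_power)

lemma sets_cell [measurable]: "cell n h x \<in> sets (lebn n)"
  unfolding cell_def by (rule sets_box) auto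

lemma cell_disjoint:
  assumes h: "0 < h" and x: "x \<in> grid n h" and y: "y \<in> grid n h" and z: "z \<in> cell n h x" "z \<in> cell n h y"
  shows "x = y"
proof
  fix i show "x i = y i"
  proof (cases "i < n")
    case True
    then obtain k l :: int where k: "x i = h * of_int k" and l: "y i = h * of_int l"
      using x y unfolding grid_def by blast
    have "x i \<le> z i" "z i < x i + h" "y i \<le> z i" "z i < y i + h"
      using z True by (auto simp: cell_def PiE_iff)
    then have "h * of_int k < h * of_int (l + 1)" "h * of_int l < h * of_int (k + 1)"
      by (auto simp: k l algebra_simps)
    then have "k < l + 1" "l < k + 1"
      using h by (auto simp only: mult_less_cancel_left_pos of_int_less_iff)
    then show ?thesis by (simp add: k l)
  next
    case False
    then show ?thesis using x y by (auto simp: grid_def Rn_def PiE_iff extensional_def)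
  qed
qed

lemma measure_Union_cells:
  assumes h: "0 < h" and F: "finite F" "F \<subseteq> grid n h"
  shows "measure (lebn n) (\<Union>x\<in>F. cell n h x) = real (card F) * h ^ n"
    "(\<Union>x\<in>F. cell n h x) \<in> fmeasurable (lebn n)"
proof -
  have "disjoint_family_on (cell n h) F"
    using cell_disjoint[OF h] F by (fastforce simp: disjoint_family_on_def)
  then have "measure (lebn n) (\<Union>x\<in>F. cell n h x) = (\<Sum>x\<in>F. measure (lebn n) (cell n h x))"
    using F h by (intro measure_finite_Union) (auto simp: emeasure_cell)
  also have "\<dots> = real (card F) * h ^ n" using h by (simp add: measure_def emeasure_cell)
  finally show "measure (lebn n) (\<Union>x\<in>F. cell n h x) = real (card F) * h ^ n" .
  show "(\<Union>x\<in>F. cell n h x) \<in> fmeasurable (lebn n)"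
    using F h by (intro fmeasurable.finite_UN fmeasurableI) (auto simp: emeasure_cell)
qed

lemma lp_dist_triangle: "1 \<le> p \<Longrightarrow> lp_dist p n x z \<le> lp_dist p n x y + lp_dist p n y z"
  using lpn_triangle[of p n "\<lambda>j. x j - y j" "\<lambda>j. y j - z j"] by (simp add: lp_dist_eq)

lemma lp_dist_commute: "lp_dist p n x y = lp_dist p n y x"
  unfolding lp_dist_eq by (rule lpn_minus_commute)

lemma lp_dist_cell:
  assumes "1 \<le> p" "1 \<le> n" "0 < h" "y \<in> cell n h x"
  shows "lp_dist p n x y \<le> real n * h"
  unfolding lp_dist_eq
proof (rule lpn_le_box)
  fix j assume "j < n"
  then have "x j \<le> y j" "y j < x j + h" using assms(4) by (auto simp: cell_def PiE_iff)
  then show "\<bar>x j - y j\<bar> \<le> h" by simp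
qed (use assms in auto)

text \<open>The cells are disjoint and fit into the ball enlarged by \<open>n * h\<close>. The bound
  is first shown for finite subsets, which then yields finiteness of \<open>F\<close>
  itself.\<close>

lemma card_grid_le:
  assumes p: "1 \<le> p" and n: "1 \<le> n" and h: "0 < h" and \<rho>: "0 < \<rho>"
    and F: "F \<subseteq> grid n h" "\<And>x. x \<in> F \<Longrightarrow> lp_dist p n a x \<le> \<rho>"
  shows "finite F" "real (card F) * h ^ n \<le> (\<rho> + real n * h) ^ n * vol1 p n"
proof -
  have \<rho>': "0 < \<rho> + real n * h" using \<rho> h by (simp add: add_pos_nonneg)
  have bound: "real (card G) * h ^ n \<le> (\<rho> + real n * h) ^ n * vol1 p n"
    if G: "G \<subseteq> F" "finite G" for G
  proof -
    have "(\<Union>x\<in>G. cell n h x) \<subseteq> lp_ball p n a (\<rho> + real n * h)"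
    proof
      fix y assume "y \<in> (\<Union>x\<in>G. cell n h x)"
      then obtain x where x: "x \<in> F" "y \<in> cell n h x" using G by auto
      have "y \<in> Rn n" using x by (auto simp: cell_def Rn_def PiE_iff)
      then show "y \<in> lp_ball p n a (\<rho> + real n * h)"
        using lp_dist_cell[OF p n h x(2)] F(2)[OF x(1)] lp_dist_triangle[OF p, of n a y x]
        by (auto simp: lp_ball_def)
    qed
    then have "measure (lebn n) (\<Union>x\<in>G. cell n h x) \<le> measure (lebn n) (lp_ball p n a (\<rho> + real n * h))"
      using measure_Union_cells[OF h, of G] G F measure_lp_ball(1)[OF p n \<rho>']
      by (intro measure_mono_fmeasurable) (auto simp: fmeasurable_def)
    then show ?thesis
      using measure_Union_cells[OF h, of G] G F measure_lp_ball(2)[OF p n \<rho>'] by auto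
  qed
  have "finite F \<and> card F \<le> nat \<lfloor>(\<rho> + real n * h) ^ n * vol1 p n / h ^ n\<rfloor>"
  proof (rule finite_if_finite_subsets_card_bdd)
    fix G assume "G \<subseteq> F" "finite G"
    from bound[OF this] show "card G \<le> nat \<lfloor>(\<rho> + real n * h) ^ n * vol1 p n / h ^ n\<rfloor>"
      using h by (simp add: le_nat_floor pos_le_divide_eq)
  qed
  then show "finite F" by simp
  then show "real (card F) * h ^ n \<le> (\<rho> + real n * h) ^ n * vol1 p n" by (intro bound) auto
qed

text \<open>Rounding every coordinate down moves a point by at most \<open>n * h\<close>, so the
  cells of \<open>V\<close> cover the smaller ball.\<close>

lemma card_grid_ge:
  assumes p: "1 \<le> p" and n: "1 \<le> n" and h: "0 < h" and \<rho>: "real n * h < \<rho>"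
  defines "V \<equiv> {x \<in> grid n h. lp_dist p n (\<lambda>_. 0) x \<le> \<rho>}"
  shows "(\<rho> - real n * h) ^ n * vol1 p n \<le> real (card V) * h ^ n"
proof -
  have "0 \<le> real n * h" using h by simp
  then have "0 < \<rho>" using \<rho> by simp
  then have fV: "finite V" by (rule card_grid_le(1)[OF p n h]) (auto simp: V_def)
  have Vg: "V \<subseteq> grid n h" by (auto simp: V_def)
  have "lp_ball p n (\<lambda>_. 0) (\<rho> - real n * h) \<subseteq> (\<Union>x\<in>V. cell n h x)"
  proof
    fix y assume y: "y \<in> lp_ball p n (\<lambda>_. 0) (\<rho> - real n * h)"
    define x where "x = (\<lambda>i\<in>{..<n}. h * of_int \<lfloor>y i / h\<rfloor>)"
    have yx: "y \<in> cell n h x"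
    proof -
      have "x i \<le> y i \<and> y i < x i + h" if "i < n" for i
      proof -
        have "of_int \<lfloor>y i / h\<rfloor> \<le> y i / h" "y i / h < of_int \<lfloor>y i / h\<rfloor> + 1" by linarith+
        then have "of_int \<lfloor>y i / h\<rfloor> * h \<le> y i" "y i < (of_int \<lfloor>y i / h\<rfloor> + 1) * h"
          using h by (simp_all only: pos_le_divide_eq pos_divide_less_eq)
        then show ?thesis using that by (simp add: x_def algebra_simps)
      qed
      then show ?thesis using y by (auto simp: cell_def lp_ball_def Rn_def PiE_iff)
    qed
    have xg: "x \<in> grid n h" by (auto simp: grid_def x_def Rn_def)
    have "lp_dist p n (\<lambda>_. 0) x \<le> \<rho>"
      using lp_dist_cell[OF p n h yx] lp_dist_triangle[OF p, of n "\<lambda>_. 0" x y] y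
      by (auto simp: lp_ball_def lp_dist_commute[of p n y x])
    with xg yx show "y \<in> (\<Union>x\<in>V. cell n h x)" by (auto simp: V_def)
  qed
  then have "measure (lebn n) (lp_ball p n (\<lambda>_. 0) (\<rho> - real n * h)) \<le> measure (lebn n) (\<Union>x\<in>V. cell n h x)"
    using measure_Union_cells[OF h fV Vg] by (intro measure_mono_fmeasurable) auto
  then show ?thesis
    using measure_Union_cells[OF h fV Vg] measure_lp_ball(2)[OF p n, of "\<rho> - real n * h"] \<rho> by simp
qed

section \<open>Packings from the grid\<close>

lemma disjoint_balls:
  assumes "1 \<le> p" "2 * r \<le> lp_dist p n x y"
  shows "lp_open_ball p n x r \<inter> lp_open_ball p n y r = {}"
proof (rule ccontr)
  assume "\<not> ?thesis"
  then obtain z where "lp_dist p n x z < r" "lp_dist p n y z < r" by (auto simp: lp_open_ball_def)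
  then show False
    using assms(2) lp_dist_triangle[OF assms(1), of n x y z] lp_dist_commute[of p n y z] by linarith
qed

text \<open>The vertices are grid points within \<open>R - r\<close> of the origin, so that their
  balls stay inside radius \<open>R\<close>. The volume of a ball of radius \<open>2 * r\<close>
  yields the degree bound \<open>D\<close>, that of the lens its sparser analogue
  \<open>B\<close>.\<close>

lemma grid_packing:
  fixes p h r \<theta> B D l m :: real
  assumes p: "1 < p" and n: "1 \<le> n" and h: "0 < h" and \<theta>: "0 < \<theta>"
  defines "r \<equiv> unit_vol_radius p n"
  assumes lens: "\<And>n u s. 0 < s \<Longrightarrow> lpn p n u \<le> s \<Longrightarrow>
    \<exists>a. \<forall>y. lpn p n y \<le> lpn p n u \<longrightarrow> lpn p n (\<lambda>j. y j - u j) \<le> s \<longrightarrow> lpn p n (\<lambda>j. y j - a j) \<le> \<theta> * s"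
  assumes D: "(2 * r + real n * h) ^ n * vol1 p n \<le> D * h ^ n"
    and B: "(\<theta> * (2 * r) + real n * h) ^ n * vol1 p n \<le> B * h ^ n"
    and l: "0 < l" "l * (2 * B) \<le> 1 / 2" "l \<le> 1" "0 \<le> m" "exp (4 * m) \<le> l * D"
    and R: "r + real n * h < R"
  shows "\<exists>P\<in>lp_packings p n. finite P \<and> (\<forall>x\<in>P. lp_dist p n (\<lambda>_. 0) x \<le> R - r) \<and>
    (\<forall>x\<in>P. \<forall>y\<in>P. x \<noteq> y \<longrightarrow> 2 * r \<le> lp_dist p n x y) \<and>
    m * ((R - r - real n * h) ^ n * vol1 p n) \<le> 2 * (D * h ^ n) * real (card P)"
proof -
  have p1: "1 \<le> p" using p by simp
  have r: "0 < r" using unit_vol_radius[OF p1 n] by (simp add: r_def)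
  define E where "E x y \<longleftrightarrow> x \<noteq> y \<and> lp_dist p n x y < 2 * r" for x y
  interpret hard_core E l
    by standard (use l in \<open>auto simp: E_def lp_dist_commute\<close>)
  define V where "V = {x \<in> grid n h. lp_dist p n (\<lambda>_. 0) x \<le> R - r}"
  have nh: "0 \<le> real n * h" using h by simp
  then have "0 < R - r" using R by linarith
  then have fV: "finite V" by (rule card_grid_le(1)[OF p1 n h]) (auto simp: V_def)
  have cancel: "x \<le> y" if "x * h ^ n \<le> y * h ^ n" for x y :: real
    using that h by simp
  have deg: "real (card {w\<in>V. E v w}) \<le> D" for v
  proof (rule cancel)
    have "real (card {w\<in>V. E v w}) * h ^ n \<le> (2 * r + real n * h) ^ n * vol1 p n"
      by (rule card_grid_le(2)[OF p1 n h, of _ _ v]) (use r in \<open>auto simp: V_def E_def\<close>)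
    with D show "real (card {w\<in>V. E v w}) * h ^ n \<le> D * h ^ n" by simp
  qed
  \<comment> \<open>Ordering by distance to \<open>v\<close> makes the counted neighbours of
    \<open>u\<close> lie in a lens: no farther from \<open>v\<close> than \<open>u\<close> is, and
    within \<open>2 * r\<close> of \<open>u\<close>.\<close>
  have sparse: "(\<Sum>u\<in>T. real (card (T \<inter> cnbh u))) \<le> 2 * B * real (card T)"
    if T: "T \<subseteq> {w\<in>V. E v w}" for v T
  proof (rule sum_card_cnbh_le[where d = "lp_dist p n v"])
    show "finite T" using T fV by (auto intro: finite_subset)
    fix u assume u: "u \<in> T"
    let ?L = "{w \<in> T \<inter> cnbh u. lp_dist p n v w \<le> lp_dist p n v u}"
    let ?u = "\<lambda>j. u j - v j"
    have uv: "lpn p n (\<lambda>j. w j - v j) = lp_dist p n v w" for w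
      using lp_dist_commute[of p n v w] by (simp add: lp_dist_eq)
    have "lpn p n ?u \<le> 2 * r" using u T by (auto simp: uv E_def)
    then obtain a where a: "\<And>y. lpn p n y \<le> lpn p n ?u \<Longrightarrow>
      lpn p n (\<lambda>j. y j - ?u j) \<le> 2 * r \<Longrightarrow> lpn p n (\<lambda>j. y j - a j) \<le> \<theta> * (2 * r)"
      using lens[of "2 * r" n ?u] r by (meson mult_pos_pos zero_less_numeral)
    have "real (card ?L) * h ^ n \<le> (\<theta> * (2 * r) + real n * h) ^ n * vol1 p n"
    proof (rule card_grid_le(2)[OF p1 n h, of _ _ "\<lambda>j. v j + a j"])
      fix w assume w: "w \<in> ?L"
      have "lpn p n (\<lambda>j. (w j - v j) - a j) \<le> \<theta> * (2 * r)"
      proof (rule a)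
        show "lpn p n (\<lambda>j. w j - v j) \<le> lpn p n ?u" using w by (simp add: uv)
        have "lp_dist p n u w \<le> 2 * r"
          using w r p1 by (auto simp: cnbh_def E_def lp_dist_def)
        then show "lpn p n (\<lambda>j. (w j - v j) - ?u j) \<le> 2 * r"
          using lp_dist_commute[of p n u w] by (simp add: lp_dist_eq)
      qed
      then show "lp_dist p n (\<lambda>j. v j + a j) w \<le> \<theta> * (2 * r)"
        using lp_dist_commute[of p n w "\<lambda>j. v j + a j"] by (simp add: lp_dist_eq diff_diff_eq)
    qed (use r \<theta> T in \<open>auto simp: V_def\<close>)
    with B show "real (card ?L) \<le> B" by (intro cancel[of "real (card ?L)"]) simp
  qed
  obtain I where I: "I \<in> indep V" "m * real (card V) \<le> 2 * D * real (card I)"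
    using exists_large_indep[OF fV deg _ l(2-5)] sparse by blast
  have IV: "I \<subseteq> V" and far: "\<forall>x\<in>I. \<forall>y\<in>I. x \<noteq> y \<longrightarrow> 2 * r \<le> lp_dist p n x y"
    using I by (auto simp: indep_def E_def not_less)
  have "I \<in> lp_packings p n"
    using IV far disjoint_balls[OF p1, of r n] by (auto simp: lp_packings_def V_def grid_def r_def)
  moreover have "m * ((R - r - real n * h) ^ n * vol1 p n) \<le> 2 * (D * h ^ n) * real (card I)"
  proof -
    have "m * ((R - r - real n * h) ^ n * vol1 p n) \<le> m * (real (card V) * h ^ n)"
      unfolding V_def using l R by (intro mult_left_mono card_grid_ge[OF p1 n h]) auto
    also have "\<dots> = (m * real (card V)) * h ^ n" by simp
    also have "\<dots> \<le> (2 * D * real (card I)) * h ^ n" using I h by (intro mult_right_mono) auto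
    finally show ?thesis by (simp add: mult_ac)
  qed
  ultimately show ?thesis using IV far fV by (intro bexI[of _ I]) (auto simp: V_def intro: finite_subset)
qed

lemma measure_packing_ge:
  fixes p r R :: real
  assumes p: "1 \<le> p" and n: "1 \<le> n"
  defines "r \<equiv> unit_vol_radius p n"
  assumes P: "finite P" "\<And>x. x \<in> P \<Longrightarrow> lp_dist p n (\<lambda>_. 0) x \<le> R - r"
    "\<And>x y. x \<in> P \<Longrightarrow> y \<in> P \<Longrightarrow> x \<noteq> y \<Longrightarrow> 2 * r \<le> lp_dist p n x y" and R: "0 < R"
  shows "real (card P) / 2
    \<le> measure (lebn n) (lp_ball p n (\<lambda>_. 0) R \<inter> (\<Union>x\<in>P. lp_ball p n x r))"
proof -
  \<comment> \<open>Closed balls of radius \<open>r\<close> may touch, so they are shrunk to half the volume; the factor is harmless.\<close>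
  define s where "s = r * root n (1 / 2)"
  have r: "0 < r" "r ^ n * vol1 p n = 1" using unit_vol_radius[OF p n] by (auto simp: r_def)
  have "root n (1 / 2) < 1" "0 < root n (1 / 2)" using n by auto
  then have s: "0 < s" "s < r" using r by (auto simp: s_def)
  have "s ^ n * vol1 p n = 1 / 2" using n r by (simp add: s_def power_mult_distrib)
  then have vol: "measure (lebn n) (lp_ball p n x s) = 1 / 2" and fm: "lp_ball p n x s \<in> fmeasurable (lebn n)" for x
    using measure_lp_ball[OF p n s(1), of x] by simp_all
  have "lp_ball p n x s \<inter> lp_ball p n y s = {}" if "x \<in> P" "y \<in> P" "x \<noteq> y" for x y
    using disjoint_balls[OF p P(3)[OF that]] s by (fastforce simp: lp_ball_def lp_open_ball_def)
  then have dis: "disjoint_family_on (\<lambda>x. lp_ball p n x s) P"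
    by (auto simp: disjoint_family_on_def)
  have "real (card P) / 2 = (\<Sum>x\<in>P. measure (lebn n) (lp_ball p n x s))" by (simp add: vol)
  also have "\<dots> = measure (lebn n) (\<Union>x\<in>P. lp_ball p n x s)"
    using P(1) dis fmeasurableD2[OF fm] by (intro measure_finite_Union[symmetric]) auto
  also have "\<dots> \<le> measure (lebn n) (lp_ball p n (\<lambda>_. 0) R \<inter> (\<Union>x\<in>P. lp_ball p n x r))"
  proof (rule measure_mono_fmeasurable)
    show "(\<Union>x\<in>P. lp_ball p n x s) \<subseteq> lp_ball p n (\<lambda>_. 0) R \<inter> (\<Union>x\<in>P. lp_ball p n x r)"
    proof
      fix y assume "y \<in> (\<Union>x\<in>P. lp_ball p n x s)"
      then obtain x where x: "x \<in> P" "y \<in> Rn n" "lp_dist p n x y \<le> s" by (auto simp: lp_ball_def)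
      have "lp_dist p n (\<lambda>_. 0) y \<le> R"
        using lp_dist_triangle[OF p, of n "\<lambda>_. 0" y x] P(2)[OF x(1)] x s by simp
      then show "y \<in> lp_ball p n (\<lambda>_. 0) R \<inter> (\<Union>x\<in>P. lp_ball p n x r)"
        using x s by (auto simp: lp_ball_def intro!: bexI[of _ x])
    qed
    show "(\<Union>x\<in>P. lp_ball p n x s) \<in> sets (lebn n)" using P(1) by auto
    show "lp_ball p n (\<lambda>_. 0) R \<inter> (\<Union>x\<in>P. lp_ball p n x r) \<in> fmeasurable (lebn n)"
      using measure_lp_ball(1)[OF p n R] P(1) by (intro fmeasurable_Int_fmeasurable) auto
  qed
  finally show ?thesis .
qed

text \<open>The 8 collects three factors 2: from \<open>exists_large_indep\<close>, from halving the
  balls in \<open>measure_packing_ge\<close>, and from the boundary loss.\<close>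

lemma packing_density_ge:
  fixes p h r \<theta> B D l m :: real
  assumes p: "1 < p" and n: "1 \<le> n" and h: "0 < h" and \<theta>: "0 < \<theta>"
  defines "r \<equiv> unit_vol_radius p n"
  assumes lens: "\<And>n u s. 0 < s \<Longrightarrow> lpn p n u \<le> s \<Longrightarrow>
    \<exists>a. \<forall>y. lpn p n y \<le> lpn p n u \<longrightarrow> lpn p n (\<lambda>j. y j - u j) \<le> s \<longrightarrow> lpn p n (\<lambda>j. y j - a j) \<le> \<theta> * s"
  assumes D: "(2 * r + real n * h) ^ n * vol1 p n \<le> D * h ^ n"
    and B: "(\<theta> * (2 * r) + real n * h) ^ n * vol1 p n \<le> B * h ^ n"
    and l: "0 < l" "l * (2 * B) \<le> 1 / 2" "l \<le> 1" "0 \<le> m" "exp (4 * m) \<le> l * D"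
  shows "ereal (m / (8 * (D * h ^ n))) \<le> packing_density p n"
  unfolding packing_density_def r_def[symmetric]
proof (rule le_Limsup)
  define c where "c = r + real n * h"
  have p1: "1 \<le> p" using p by simp
  have r: "0 < r" "r ^ n * vol1 p n = 1" using unit_vol_radius[OF p1 n] by (auto simp: r_def)
  have V: "0 < vol1 p n" using emeasure_unit_lp_ball[OF p1 n] by simp
  have nh: "0 \<le> real n * h" using h by simp
  have c: "0 < c" using r nh by (simp add: c_def add_pos_nonneg)
  have "0 < l * D" using l(5) by (rule less_le_trans[OF exp_gt_zero])
  then have "0 < D" using l by (simp add: zero_less_mult_iff)
  then have Dh: "0 < D * h ^ n" using h by simp
  show "\<forall>\<^sub>F R in at_top. ereal (m / (8 * (D * h ^ n))) \<le> (SUP P\<in>lp_packings p n.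
        ereal (measure (lebn n) (lp_ball p n (\<lambda>_. 0) R \<inter> (\<Union>x\<in>P. lp_ball p n x r))
               / measure (lebn n) (lp_ball p n (\<lambda>_. 0) R)))"
    using eventually_ge_at_top[of "2 * real n * c"] eventually_gt_at_top[of c]
  proof eventually_elim
    case (elim R)
    have R: "0 < R" using elim c by simp
    obtain P where P: "P \<in> lp_packings p n" "finite P" "\<forall>x\<in>P. lp_dist p n (\<lambda>_. 0) x \<le> R - r"
      "\<forall>x\<in>P. \<forall>y\<in>P. x \<noteq> y \<longrightarrow> 2 * r \<le> lp_dist p n x y"
      "m * ((R - r - real n * h) ^ n * vol1 p n) \<le> 2 * (D * h ^ n) * real (card P)"
      using grid_packing[OF p n h \<theta> lens, of D B l m R] D B l elim unfolding r_def c_def by blast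
    \<comment> \<open>For such \<open>R\<close>, Bernoulli's inequality shows that the grid region
      retains at least half of the volume of the large ball.\<close>
    have "real n * c / R \<le> 1 / 2" using elim R by (simp add: field_simps)
    then have "1 / 2 \<le> 1 + real n * (- c / R)" by simp
    also have "\<dots> \<le> (1 + (- c / R)) ^ n" using elim R by (intro Bernoulli_inequality) (simp add: field_simps)
    also have "1 + (- c / R) = (R - r - real n * h) / R" using R by (simp add: c_def field_simps)
    finally have "R ^ n / 2 \<le> (R - r - real n * h) ^ n" using R by (simp add: power_divide field_simps)
    then have "m * (R ^ n / 2 * vol1 p n) \<le> m * ((R - r - real n * h) ^ n * vol1 p n)"
      using l V by (intro mult_left_mono mult_right_mono) auto
    with P(5) have "m * (R ^ n / 2 * vol1 p n) \<le> 2 * (D * h ^ n) * real (card P)" by linarith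
    then have "m / (8 * (D * h ^ n)) \<le> (real (card P) / 2) / (R ^ n * vol1 p n)"
      using Dh R V by (simp add: divide_simps mult_ac)
    also have "\<dots> \<le> measure (lebn n) (lp_ball p n (\<lambda>_. 0) R \<inter> (\<Union>x\<in>P. lp_ball p n x r)) / (R ^ n * vol1 p n)"
      using P R V unfolding r_def by (intro divide_right_mono measure_packing_ge[OF p1 n]) auto
    also have "R ^ n * vol1 p n = measure (lebn n) (lp_ball p n (\<lambda>_. 0) R)"
      using measure_lp_ball(2)[OF p1 n R] by simp
    finally show ?case using P(1) by (intro SUP_upper2[of P]) simp_all
  qed
qed simp

section \<open>Choice of the parameters\<close>

theorem theorem1:
  fixes p :: real
  assumes "1 < p" and "p \<le> 2"
  shows "\<exists>c::real. 0 < c \<and> c < 2 \<and>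
           (\<exists>\<epsilon>::nat \<Rightarrow> real. \<epsilon> \<longlonglongrightarrow> 0 \<and>
              (\<forall>\<^sub>F n in sequentially.
                 packing_density p n \<ge> ereal ((1 + \<epsilon> n) * (ln (2 / c) * real n / 2 ^ n))))"
proof -
  obtain \<theta> where \<theta>: "0 < \<theta>" "\<theta> < 1" and lens: "\<And>n u s. 0 < s \<Longrightarrow> lpn p n u \<le> s \<Longrightarrow>
    \<exists>a. \<forall>y. lpn p n y \<le> lpn p n u \<longrightarrow> lpn p n (\<lambda>j. y j - u j) \<le> s \<longrightarrow> lpn p n (\<lambda>j. y j - a j) \<le> \<theta> * s"
    using lens_in_ball[OF assms] by blast
  \<comment> \<open>Halfway between \<open>\<theta>\<close> and 1, this absorbs the grid error:
    \<open>2 * \<theta> + 1 / n \<le> 2 * \<theta>'\<close> for large \<open>n\<close>.\<close>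
  define \<theta>' where "\<theta>' = (1 + \<theta>) / 2"
  define L where "L = - ln \<theta>'"
  have \<theta>': "0 < \<theta>'" "\<theta>' < 1" using \<theta> by (auto simp: \<theta>'_def)
  have L: "0 < L" using \<theta>' by (simp add: L_def)
  have p1: "1 \<le> p" using assms by simp
  have "\<forall>\<^sub>F n in sequentially. nat \<lceil>1 / (1 - \<theta>)\<rceil> + nat \<lceil>1 / L\<rceil> + 1 \<le> n"
    by (rule eventually_ge_at_top)
  then have main: "\<forall>\<^sub>F n in sequentially. ereal (L / 192 * real n / 2 ^ n) \<le> packing_density p n"
  proof eventually_elim
    case (elim n)
    have n: "1 \<le> n" using elim by simp
    have "1 / (1 - \<theta>) \<le> real n" "1 / L \<le> real n" using elim by linarith+
    then have n\<theta>: "1 / real n \<le> 1 - \<theta>" and nL: "1 \<le> real n * L"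
      using \<theta> L n by (auto simp: field_simps)
    define r where "r = unit_vol_radius p n"
    have r: "0 < r" "r ^ n * vol1 p n = 1" using unit_vol_radius[OF p1 n] by (auto simp: r_def)
    \<comment> \<open>With this mesh the enlargement \<open>n * h\<close> is \<open>r / n\<close>,
      which changes the volume of a ball of radius \<open>2 * r\<close> by a bounded factor
      only.\<close>
    define h where "h = r / real n ^ 2"
    have h: "0 < h" using r n by (simp add: h_def)
    have nh: "real n * h = r * (1 / real n)" using n by (simp add: h_def power2_eq_square)
    define D where "D = 3 * 2 ^ n / h ^ n"
    define B where "B = (2 * \<theta>') ^ n / h ^ n"
    \<comment> \<open>This is the largest fugacity with \<open>l * (2 * B) \<le> 1 / 2\<close>. It
      gives \<open>l * D = 3 / 4 * exp (n * L)\<close>; as \<open>4 * m\<close> is only half of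
      \<open>n * L\<close>, the spare exponential absorbs the 3/4.\<close>
    define l where "l = 1 / (4 * B)"
    define m where "m = real n * L / 8"
    have Bpos: "0 < B" using \<theta>' h by (simp add: B_def)
    have Dh: "D * h ^ n = 3 * 2 ^ n" using h by (simp add: D_def)
    have Bh: "B * h ^ n = (2 * \<theta>') ^ n" using h by (simp add: B_def)
    have D: "(2 * r + real n * h) ^ n * vol1 p n \<le> D * h ^ n"
    proof -
      have "(1 + 1 / (2 * real n)) ^ n \<le> exp (1 / (2 * real n)) ^ n"
        by (intro power_mono) (use exp_ge_add_one_self in auto)
      also have "\<dots> = exp (1 / 2)" using n by (simp flip: exp_of_nat_mult)
      also have "\<dots> \<le> exp 1" by simp
      also have "\<dots> \<le> 3" by (rule exp_le)
      finally have e: "(1 + 1 / (2 * real n)) ^ n \<le> 3" .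
      have "2 * r + real n * h = (2 * r) * (1 + 1 / (2 * real n))" unfolding nh using n by (simp add: field_simps)
      then have "(2 * r + real n * h) ^ n * vol1 p n = 2 ^ n * (1 + 1 / (2 * real n)) ^ n * (r ^ n * vol1 p n)"
        by (simp add: power_mult_distrib)
      also have "\<dots> \<le> 2 ^ n * 3" unfolding r(2) using e by simp
      finally show ?thesis by (simp add: Dh)
    qed
    have B: "(\<theta> * (2 * r) + real n * h) ^ n * vol1 p n \<le> B * h ^ n"
    proof -
      have "\<theta> * (2 * r) + real n * h = r * (2 * \<theta> + 1 / real n)" unfolding nh by (simp add: algebra_simps)
      then have "(\<theta> * (2 * r) + real n * h) ^ n * vol1 p n = (2 * \<theta> + 1 / real n) ^ n * (r ^ n * vol1 p n)"
        by (simp add: power_mult_distrib)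
      also have "\<dots> \<le> (2 * \<theta>') ^ n" unfolding r(2) mult_1_right
        using \<theta> n\<theta> by (intro power_mono) (auto simp: \<theta>'_def)
      finally show ?thesis by (simp add: Bh)
    qed
    \<comment> \<open>Counting just the origin shows \<open>1 \<le> B\<close>, which gives
      \<open>l \<le> 1\<close>.\<close>
    have "real (card {\<lambda>i\<in>{..<n}. 0 :: real}) * h ^ n \<le> (\<theta> * (2 * r) + real n * h) ^ n * vol1 p n"
      using r \<theta> by (intro card_grid_le(2)[OF p1 n h, of _ _ "\<lambda>_. 0"])
        (auto simp: grid_def Rn_def lp_dist_def intro: exI[of _ 0])
    with B have "1 * h ^ n \<le> B * h ^ n" by simp
    then have B1: "1 \<le> B" using h by simp
    have l: "0 < l" "l * (2 * B) \<le> 1 / 2" "l \<le> 1" using B1 by (auto simp: l_def divide_simps)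
    define x where "x = real n * L"
    have "exp (4 * m) \<le> l * D"
    proof -
      have "exp x = (exp L) ^ n" by (simp add: x_def exp_of_nat_mult)
      also have "exp L = 1 / \<theta>'" using \<theta>' by (simp add: L_def exp_minus inverse_eq_divide)
      finally have eL: "l * D = 3 / 4 * exp x"
        using h \<theta>' by (simp add: l_def D_def B_def power_mult_distrib power_divide)
      have "1 + x / 2 \<le> exp (x / 2)" by (rule exp_ge_add_one_self)
      then have "1 \<le> 3 / 4 * exp (x / 2)" using nL unfolding x_def by linarith
      then have "exp (x / 2) * 1 \<le> exp (x / 2) * (3 / 4 * exp (x / 2))"
        by (intro mult_left_mono) auto
      also have "\<dots> = 3 / 4 * (exp (x / 2) * exp (x / 2))" by simp
      also have "\<dots> = 3 / 4 * exp x" by (simp flip: exp_add)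
      finally show ?thesis by (simp add: eL m_def flip: x_def)
    qed
    then have "ereal (m / (8 * (D * h ^ n))) \<le> packing_density p n"
      using D B l L unfolding r_def
      by (intro packing_density_ge[OF assms(1) n h \<theta>(1) lens, of D B l m]) (auto simp: m_def)
    \<comment> \<open>The constant 192 is 8 from \<open>m\<close>, 8 from
      \<open>packing_density_ge\<close> and 3 from \<open>D * h ^ n\<close>.\<close>
    then show ?case by (simp add: Dh m_def mult.commute[of L])
  qed
  \<comment> \<open>Solves \<open>ln (2 / c) = L / 192\<close>, so the error sequence can be taken
    to be 0.\<close>
  define c where "c = 2 * exp (- (L / 192))"
  have c: "0 < c" "c < 2" using L by (auto simp: c_def)
  have lnc: "ln (2 / c) = L / 192" by (simp add: c_def ln_div)
  show ?thesis using main[folded lnc] c by (intro exI[of _ c] conjI exI[of _ "\<lambda>_. 0"]) simp_all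
qed

end
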